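(* Let $R\in(0,1)$ be a solution of the equation $R=\pi_R(\mathcal{X}_+^c)$, let $\pi=\pi_R$, and assume that the spectral gap $\kappa_R$ of $(\Lambda_R(t))$ satisfies $$\kappa_R>\frac{\lambda}{1-R}\sqrt{\frac{C}{\rho_2}}.$$ Then there exist positive constants $q$ and $\varepsilon_0$ such that, if $\|\Lambda(0)-\pi\|_2\le\varepsilon_0$, then the solution $(\Lambda(t))$ of the non-linear system (NL) with initial state $\Lambda(0)$ satisfies $$\frac{\mathrm{d}}{\mathrm{d}t}\|\Lambda(t)-\pi\|_2^2\le -q\,\|\Lambda(t)-\pi\|_2^2\qquad\text{for all }t\ge0.$$ In particular, $\pi$ is an exponentially stable equilibrium point of $(\Lambda(t))$.
   Context: Let $C\ge1$ be an integer, $\lambda>0$, $0<\mu_2<\mu_1$, $\rho_1=\lambda/\mu_1$, $\rho_2=\lambda/\mu_2$. Let $\mathcal{X}=\{(x,y)\in\mathbb{N}^2:x+y\le C\}$, $\mathcal{X}_+=\{(x,y)\in\mathbb{N}^2:x+y<C\}$, $\mathcal{X}_+^c=\mathcal{X}\setminus\mathcal{X}_+$, and let $\mathcal{P}(\mathcal{X})$ be the set of probability distributions on $\mathcal{X}$. Write $\langle\zeta,f\rangle=\sum_{z\in\mathcal{X}}f(z)\zeta(z)$. For $f:\mathcal{X}\to\mathbb{R}$ put $\nabla_1^{\pm}(f)(x,y)=f(x\pm1,y)-f(x,y)$, $\nabla_2^{\pm}(f)(x,y)=f(x,y\pm1)-f(x,y)$, $I_1(x,y)=x$, $I_2(x,y)=y$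 (products such as $\nabla_i^+(f)\mathbf{1}_{\mathcal{X}_+}$ and $I_i\nabla_i^-(f)$ are $0$ where the indicator, resp. $I_i$, vanishes). Non-linear system (NL): $(\Lambda(t))$ is the $\mathcal{P}(\mathcal{X})$-valued solution of, for every $f:\mathcal{X}\to\mathbb{R}$, $$\frac{\mathrm{d}}{\mathrm{d}t}\langle\Lambda(t),f\rangle=\lambda\langle\Lambda(t),\nabla_1^+(f)\mathbf{1}_{\mathcal{X}_+}\rangle+\mu_1\langle\Lambda(t),I_1\nabla_1^-(f)\rangle+\lambda\frac{\Lambda(t)(\mathcal{X}_+^c)}{\Lambda(t)(\mathcal{X}_+)}\langle\Lambda(t),\nabla_2^+(f)\mathbf{1}_{\mathcal{X}_+}\rangle+\mu_2\langle\Lambda(t),I_2\nabla_2^-(f)\rangle,$$ which is well defined as long as $\Lambda(t)(\mathcal{X}_+)>0$. Linear system: for $R\in(0,1)$, $(\Lambda_R(t))$ is the $\mathcal{P}(\mathcal{X})$-valued solution of the same equations with the ratio $\Lambda(t)(\mathcal{X}_+^c)/\Lambda(t)(\mathcal{X}_+)$ replaced by the constant $R/(1-R)$. It describes the law of an ergodic reversible Markov process on $\mathcal{X}$ whose invariant distribution is $$\pi_R(x,y)=\frac1{Z_R}\,\frac{\rho_1^x}{x!}\,\frac{\rho_2^y}{y!}\left(\frac{R}{1-R}\right)^y,\quad(x,y)\in\mathcal{X},$$ with $Z_R$ the normalization constant. Norm: for $\mu\in\mathcal{P}(\mathcal{X})$, $\|\mu-\pi\|_2^2=\sum_{z\in\mathcal{X}}\frac{(\mu(z)-\pi(z))^2}{\pi(z)}$.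 Spectral gap: $\kappa_R>0$ is the maximal constant such that $\frac{\mathrm{d}}{\mathrm{d}t}\|\Lambda_R(t)-\pi_R\|_2^2\le-2\kappa_R\|\Lambda_R(t)-\pi_R\|_2^2$ for all $t\ge0$ (and all initial states $\Lambda_R(0)\in\mathcal{P}(\mathcal{X})$). *)

theory Defs
  imports "HOL-Probability.Probability"
begin

definition states :: "nat \<Rightarrow> (nat \<times> nat) set" where
  "states C = {(x, y). x + y \<le> C}"

definition free_states :: "nat \<Rightarrow> (nat \<times> nat) set" where
  "free_states C = {(x, y). x + y < C}"

definition full_states :: "nat \<Rightarrow> (nat \<times> nat) set" where
  "full_states C = states C - free_states C"

definition distributions :: "nat \<Rightarrow> (nat \<times> nat) pmf set" where
  "distributions C = {p. set_pmf p \<subseteq> states C}"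

definition pairing :: "nat \<Rightarrow> (nat \<times> nat) pmf \<Rightarrow> (nat \<times> nat \<Rightarrow> real) \<Rightarrow> real" where
  "pairing C p f = (\<Sum>z\<in>states C. f z * pmf p z)"

(* Functions on the state space are total functions on pairs of naturals. Values outside
   "states C", and the truncated subtractions at x = 0 and y = 0, only ever occur
   multiplied by the indicator of "free_states C", by x or by y, which is then 0. *)

definition nabla1_plus :: "(nat \<times> nat \<Rightarrow> real) \<Rightarrow> nat \<times> nat \<Rightarrow> real" where
  "nabla1_plus f = (\<lambda>(x, y). f (x + 1, y) - f (x, y))"

definition nabla1_minus :: "(nat \<times> nat \<Rightarrow> real) \<Rightarrow> nat \<times> nat \<Rightarrow> real" where
  "nabla1_minus f = (\<lambda>(x, y). f (x - 1, y) - f (x, y))"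

definition nabla2_plus :: "(nat \<times> nat \<Rightarrow> real) \<Rightarrow> nat \<times> nat \<Rightarrow> real" where
  "nabla2_plus f = (\<lambda>(x, y). f (x, y + 1) - f (x, y))"

definition nabla2_minus :: "(nat \<times> nat \<Rightarrow> real) \<Rightarrow> nat \<times> nat \<Rightarrow> real" where
  "nabla2_minus f = (\<lambda>(x, y). f (x, y - 1) - f (x, y))"

(* Common right-hand side of the two systems; r is the factor multiplying the
   second arrival term. *)
definition drift :: "nat \<Rightarrow> real \<Rightarrow> real \<Rightarrow> real \<Rightarrow> real \<Rightarrow> (nat \<times> nat) pmf
    \<Rightarrow> (nat \<times> nat \<Rightarrow> real) \<Rightarrow> real" where
  "drift C l \<mu>\<^sub>1 \<mu>\<^sub>2 r p f =
     l * pairing C p (\<lambda>z. nabla1_plus f z * indicator (free_states C) z)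
   + \<mu>\<^sub>1 * pairing C p (\<lambda>z. real (fst z) * nabla1_minus f z)
   + l * r * pairing C p (\<lambda>z. nabla2_plus f z * indicator (free_states C) z)
   + \<mu>\<^sub>2 * pairing C p (\<lambda>z. real (snd z) * nabla2_minus f z)"

(* Solutions are defined on the whole half-line; the derivative at 0 is one-sided. *)

definition nonlinear_solution ::
    "nat \<Rightarrow> real \<Rightarrow> real \<Rightarrow> real \<Rightarrow> (real \<Rightarrow> (nat \<times> nat) pmf) \<Rightarrow> bool" where
  "nonlinear_solution C l \<mu>\<^sub>1 \<mu>\<^sub>2 \<Lambda> \<longleftrightarrow>
     (\<forall>t\<ge>0. \<Lambda> t \<in> distributions C \<and> measure_pmf.prob (\<Lambda> t) (free_states C) > 0 \<and>
        (\<forall>f. ((\<lambda>s. pairing C (\<Lambda> s) f) has_real_derivative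
           drift C l \<mu>\<^sub>1 \<mu>\<^sub>2
             (measure_pmf.prob (\<Lambda> t) (full_states C) / measure_pmf.prob (\<Lambda> t) (free_states C))
             (\<Lambda> t) f) (at t within {0..})))"

definition linear_solution ::
    "nat \<Rightarrow> real \<Rightarrow> real \<Rightarrow> real \<Rightarrow> real \<Rightarrow> (real \<Rightarrow> (nat \<times> nat) pmf) \<Rightarrow> bool" where
  "linear_solution C l \<mu>\<^sub>1 \<mu>\<^sub>2 R \<Lambda> \<longleftrightarrow>
     (\<forall>t\<ge>0. \<Lambda> t \<in> distributions C \<and>
        (\<forall>f. ((\<lambda>s. pairing C (\<Lambda> s) f) has_real_derivative
           drift C l \<mu>\<^sub>1 \<mu>\<^sub>2 (R / (1 - R)) (\<Lambda> t) f) (at t within {0..})))"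

definition inv_weight :: "real \<Rightarrow> real \<Rightarrow> real \<Rightarrow> nat \<times> nat \<Rightarrow> real" where
  "inv_weight \<rho>\<^sub>1 \<rho>\<^sub>2 R = (\<lambda>(x, y). \<rho>\<^sub>1 ^ x / fact x * (\<rho>\<^sub>2 ^ y / fact y) * (R / (1 - R)) ^ y)"

definition inv_norm :: "nat \<Rightarrow> real \<Rightarrow> real \<Rightarrow> real \<Rightarrow> real" where
  "inv_norm C \<rho>\<^sub>1 \<rho>\<^sub>2 R = (\<Sum>z\<in>states C. inv_weight \<rho>\<^sub>1 \<rho>\<^sub>2 R z)"

definition inv_dist :: "nat \<Rightarrow> real \<Rightarrow> real \<Rightarrow> real \<Rightarrow> (nat \<times> nat) pmf" where
  "inv_dist C \<rho>\<^sub>1 \<rho>\<^sub>2 R = embed_pmf (\<lambda>z. if z \<in> states C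
     then 1 / inv_norm C \<rho>\<^sub>1 \<rho>\<^sub>2 R * inv_weight \<rho>\<^sub>1 \<rho>\<^sub>2 R z else 0)"

lemma finite_states [simp]: "finite (states C)"
  by (rule finite_subset[of _ "{..C} \<times> {..C}"]) (auto simp: states_def)

lemma inv_norm_pos:
  assumes "\<rho>\<^sub>1 > 0" "\<rho>\<^sub>2 > 0" "0 < R" "R < 1"
  shows "inv_norm C \<rho>\<^sub>1 \<rho>\<^sub>2 R > 0"
proof -
  have "(0, 0) \<in> states C" by (simp add: states_def)
  then show ?thesis
    unfolding inv_norm_def using assms
    by (intro sum_pos) (auto simp: inv_weight_def)
qed

lemma pmf_inv_dist:
  assumes "\<rho>\<^sub>1 > 0" "\<rho>\<^sub>2 > 0" "0 < R" "R < 1"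
  shows "pmf (inv_dist C \<rho>\<^sub>1 \<rho>\<^sub>2 R) z = (if z \<in> states C
     then 1 / inv_norm C \<rho>\<^sub>1 \<rho>\<^sub>2 R * inv_weight \<rho>\<^sub>1 \<rho>\<^sub>2 R z else 0)"
proof -
  define g where "g = (\<lambda>z. if z \<in> states C
     then 1 / inv_norm C \<rho>\<^sub>1 \<rho>\<^sub>2 R * inv_weight \<rho>\<^sub>1 \<rho>\<^sub>2 R z else 0)"
  note Z = inv_norm_pos[OF assms, of C]
  have nonneg: "g x \<ge> 0" for x
    using Z assms by (auto simp: g_def inv_weight_def split: prod.split)
  have "(\<integral>\<^sup>+x. ennreal (g x) \<partial>count_space UNIV) = (\<Sum>x\<in>states C. ennreal (g x))"
    by (intro nn_integral_count_space'[of "states C"]) (auto simp: g_def)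
  also have "\<dots> = ennreal (\<Sum>x\<in>states C. g x)"
    by (rule sum_ennreal) (rule nonneg)
  also have "(\<Sum>x\<in>states C. g x) = 1"
    using Z by (simp add: g_def sum_divide_distrib[symmetric] inv_norm_def)
  finally have "(\<integral>\<^sup>+x. ennreal (g x) \<partial>count_space UNIV) = 1" by simp
  then have "pmf (embed_pmf g) z = g z"
    by (rule pmf_embed_pmf[OF nonneg])
  then show ?thesis by (simp add: g_def inv_dist_def)
qed

lemma inv_dist_in_distributions:
  assumes "\<rho>\<^sub>1 > 0" "\<rho>\<^sub>2 > 0" "0 < R" "R < 1"
  shows "inv_dist C \<rho>\<^sub>1 \<rho>\<^sub>2 R \<in> distributions C"
  using pmf_inv_dist[OF assms, of C]
  by (auto simp: distributions_def set_pmf_eq split: if_splits)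

(* The norm of p - q, weighted by 1/q. *)
definition norm2 :: "nat \<Rightarrow> (nat \<times> nat) pmf \<Rightarrow> (nat \<times> nat) pmf \<Rightarrow> real" where
  "norm2 C p q = sqrt (\<Sum>z\<in>states C. (pmf p z - pmf q z)\<^sup>2 / pmf q z)"

definition norm2_decay ::
    "nat \<Rightarrow> (nat \<times> nat) pmf \<Rightarrow> real \<Rightarrow> (real \<Rightarrow> (nat \<times> nat) pmf) \<Rightarrow> bool" where
  "norm2_decay C q k \<Lambda> \<longleftrightarrow>
     (\<forall>t\<ge>0. \<exists>D. ((\<lambda>s. (norm2 C (\<Lambda> s) q)\<^sup>2) has_real_derivative D) (at t within {0..}) \<and>
        D \<le> - k * (norm2 C (\<Lambda> t) q)\<^sup>2)"

definition gap_bound :: "nat \<Rightarrow> real \<Rightarrow> real \<Rightarrow> real \<Rightarrow> real \<Rightarrow> real \<Rightarrow> bool" where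
  "gap_bound C l \<mu>\<^sub>1 \<mu>\<^sub>2 R k \<longleftrightarrow>
     (\<forall>\<Lambda>. linear_solution C l \<mu>\<^sub>1 \<mu>\<^sub>2 R \<Lambda> \<longrightarrow>
        norm2_decay C (inv_dist C (l / \<mu>\<^sub>1) (l / \<mu>\<^sub>2) R) (2 * k) \<Lambda>)"

definition is_spectral_gap :: "nat \<Rightarrow> real \<Rightarrow> real \<Rightarrow> real \<Rightarrow> real \<Rightarrow> real \<Rightarrow> bool" where
  "is_spectral_gap C l \<mu>\<^sub>1 \<mu>\<^sub>2 R \<kappa> \<longleftrightarrow>
     \<kappa> > 0 \<and> gap_bound C l \<mu>\<^sub>1 \<mu>\<^sub>2 R \<kappa> \<and> (\<forall>k. gap_bound C l \<mu>\<^sub>1 \<mu>\<^sub>2 R k \<longrightarrow> k \<le> \<kappa>)"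

definition exponentially_stable_equilibrium ::
    "nat \<Rightarrow> real \<Rightarrow> real \<Rightarrow> real \<Rightarrow> (nat \<times> nat) pmf \<Rightarrow> bool" where
  "exponentially_stable_equilibrium C l \<mu>\<^sub>1 \<mu>\<^sub>2 q \<longleftrightarrow>
     nonlinear_solution C l \<mu>\<^sub>1 \<mu>\<^sub>2 (\<lambda>t. q) \<and>
     (\<exists>M>0. \<exists>a>0. \<exists>\<delta>>0. \<forall>p\<in>distributions C. norm2 C p q \<le> \<delta> \<longrightarrow>
        (\<exists>\<Lambda>. nonlinear_solution C l \<mu>\<^sub>1 \<mu>\<^sub>2 \<Lambda> \<and> \<Lambda> 0 = p) \<and>
        (\<forall>\<Lambda>. nonlinear_solution C l \<mu>\<^sub>1 \<mu>\<^sub>2 \<Lambda> \<and> \<Lambda> 0 = p \<longrightarrow>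
           (\<forall>t\<ge>0. norm2 C (\<Lambda> t) q \<le> M * exp (- a * t) * norm2 C p q)))"

end

theory Submission
  imports Defs
begin

text \<open>Differentiating the squared norm along a nonlinear trajectory and writing the density as
  \<open>1 + h\<close> splits the derivative into the drift of the linear system, which the gap bounds, and
  the change of rate. To leading order the latter is a product of two linear functionals of \<open>h\<close>,
  the deviation of the free mass and the \<open>\<pi>\<close>-average of the increments of \<open>h\<close> in the second
  coordinate. Cauchy-Schwarz with the variance bounds \<open>R (1 - R)\<close> and \<open>C (1 - R) / (\<rho>\<^sub>2 R)\<close> gives exactly
  the threshold of the theorem. The remainder is cubic in the norm, so the squared norm decreases
  near \<open>\<pi>\<close>, and small balls trap trajectories. Trajectories exist globally by Picard iteration
  for a vector field that is truncated away from the simplex and from zero free mass.\<close>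

subsection \<open>Differential inequalities and differential equations\<close>

text \<open>The spectral gap is given only through trajectories, and the conclusion asserts global
  existence, so linear and nonlinear solutions both have to be constructed. One construction serves
  both: the rate is a bounded Lipschitz function of the free mass \<open>a\<close>, constant in the
  linear case and a truncation of \<open>1 / a - 1\<close> in the nonlinear one. The obstacle is the
  singularity at \<open>a = 0\<close>, which cannot be excluded in advance. In a small ball around
  \<pi> the free mass is bounded below, so the truncation is not felt there; the decay estimate
  keeps the truncated solution in that ball, hence it solves the true system for all times. Origin
  of the threshold: the product of the two variance bounds is
  \<open>(1 - R)^2 * C / \<rho>\<^sub>2\<close>, in which the lone factor R has cancelled. The
  deviation \<delta> of the free mass changes the rate by \<open>- \<delta> / (a * (1 - R))\<close>
  with \<open>a\<close> close to \<open>1 - R\<close>, so the perturbation costs about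
  \<open>2 * l / (1 - R) * sqrt (C / \<rho>\<^sub>2)\<close> times the squared norm, against
  \<open>2 * \<kappa>\<close> from the gap.\<close>

lemma has_real_derivative_continuous_on_nonneg:
  fixes g :: "real \<Rightarrow> real"
  assumes "\<And>t. 0 \<le> t \<Longrightarrow> (g has_real_derivative g' t) (at t within {0..})"
  shows "continuous_on {0..} g"
  using assms by (auto simp: continuous_on_eq_continuous_within intro: DERIV_continuous)

lemma nonincreasing_nonneg_half_line:
  fixes g :: "real \<Rightarrow> real"
  assumes der: "\<And>t. 0 \<le> t \<Longrightarrow> (g has_real_derivative g' t) (at t within {0..})"
    and neg: "\<And>t. s < t \<Longrightarrow> t < u \<Longrightarrow> g' t \<le> 0"
    and "0 \<le> s" "s \<le> u"
  shows "g u \<le> g s"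
proof (rule DERIV_nonpos_imp_decreasing_open[where f = g])
  fix t assume t: "s < t" "t < u"
  have "(g has_real_derivative g' t) (at t)"
    using der[of t] t assms(3) at_within_interior[of t "{0..}"] by simp
  then show "\<exists>y. (g has_real_derivative y) (at t) \<and> y \<le> 0"
    using neg t by blast
next
  show "continuous_on {s..u} g"
    using has_real_derivative_continuous_on_nonneg[OF der] by (rule continuous_on_subset) (use assms in auto)
qed (use assms in auto)

text \<open>To rise above \<open>a\<close> a continuous path must cross the strip between
  \<open>a\<close> and \<open>b\<close>, where it cannot increase. Nothing is required of the
  derivative outside the strip. This yields both positivity of coordinates and invariance of
  balls.\<close>

lemma derivative_barrier:
  fixes g :: "real \<Rightarrow> real"
  assumes der: "\<And>t. 0 \<le> t \<Longrightarrow> (g has_real_derivative g' t) (at t within {0..})"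
    and neg: "\<And>t. 0 \<le> t \<Longrightarrow> a < g t \<Longrightarrow> g t < b \<Longrightarrow> g' t \<le> 0"
    and "a < b" "g 0 \<le> a" "0 \<le> t"
  shows "g t \<le> a"
proof (rule ccontr)
  assume "\<not> g t \<le> a"
  \<comment> \<open>The level lies below \<open>b\<close>, so that the path stays in the strip until
    it first reaches \<open>c\<close>, and below \<open>g t\<close>, so that it is reached at all.
    \<open>T\<close> is the first time at level \<open>c\<close>, \<open>S\<close> the last time
    before it at or below \<open>a\<close>.\<close>
  define c where "c = min (g t) ((a + b) / 2)"
  have c: "a < c" "c < b" "c \<le> g t"
    using \<open>a < b\<close> \<open>\<not> g t \<le> a\<close> by (auto simp: c_def min_less_iff_disj)
  note cont = has_real_derivative_continuous_on_nonneg[OF der]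
  define T where "T = Inf {s \<in> {0..t}. c \<le> g s}"
  have cont_t: "continuous_on {0..t} g"
    using cont by (rule continuous_on_subset) auto
  have closed1: "closed {s \<in> {0..t}. c \<le> g s}"
    using continuous_on_closed_Collect_le[OF continuous_on_const cont_t] by simp
  have T: "T \<in> {s \<in> {0..t}. c \<le> g s}"
    unfolding T_def by (rule closed_contains_Inf) (use closed1 c \<open>0 \<le> t\<close> in \<open>auto intro!: bdd_belowI[of _ 0]\<close>)
  have before_T: "g s < c" if "0 \<le> s" "s < T" for s
  proof (rule ccontr)
    assume "\<not> g s < c"
    then have "T \<le> s"
      unfolding T_def using that T by (intro cInf_lower) (auto intro!: bdd_belowI[of _ 0])
    then show False using that by simp
  qed
  define S where "S = Sup {s \<in> {0..T}. g s \<le> a}"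
  have closed2: "closed {s \<in> {0..T}. g s \<le> a}"
    using continuous_on_closed_Collect_le[OF continuous_on_subset[OF cont_t, of "{0..T}"]
        continuous_on_const] T
    by simp
  have S: "S \<in> {s \<in> {0..T}. g s \<le> a}"
    unfolding S_def by (rule closed_contains_Sup) (use closed2 assms T in \<open>auto intro!: bdd_aboveI[of _ T]\<close>)
  have after_S: "a < g s" if "S < s" "s \<le> T" for s
  proof (rule ccontr)
    assume "\<not> a < g s"
    then have "s \<le> S"
      unfolding S_def using that S by (intro cSup_upper) (auto intro!: bdd_aboveI[of _ T])
    then show False using that by simp
  qed
  have "g T \<le> g S"
  proof (rule nonincreasing_nonneg_half_line[OF der])
    fix s assume "S < s" "s < T"
    then show "g' s \<le> 0"
      using S before_T[of s] after_S[of s] c by (intro neg) auto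
  qed (use S in auto)
  then show False using S T c by auto
qed

text \<open>The integral of \<open>exp (2 * L * s)\<close> up to \<open>t\<close> is at most
  \<open>exp (2 * L * t) / (2 * L)\<close>, which the weight cancels. With \<open>K\<close> equal to
  \<open>L\<close> times a distance this gives the contraction factor 1/2.\<close>

lemma weighted_integral_bound:
  fixes g :: "real \<Rightarrow> 'a::banach"
  assumes "L > 0" "0 \<le> t" "continuous_on {0..t} g"
    and bound: "\<And>s. 0 \<le> s \<Longrightarrow> s \<le> t \<Longrightarrow> norm (g s) \<le> K * exp (2 * L * s)"
    and "K \<ge> 0"
  shows "norm (exp (- (2 * L * t)) *\<^sub>R integral {0..t} g) \<le> K / (2 * L)"
proof -
  have int: "((\<lambda>s. K * exp (2 * L * s)) has_integral
      K / (2 * L) * exp (2 * L * t) - K / (2 * L) * exp (2 * L * 0)) {0..t}"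
    using assms by (intro fundamental_theorem_of_calculus)
      (auto intro!: derivative_eq_intros simp: has_real_derivative_iff_has_vector_derivative[symmetric])
  have "norm (integral {0..t} g) \<le> integral {0..t} (\<lambda>s. K * exp (2 * L * s))"
    using assms by (intro integral_norm_bound_integral integrable_continuous_real
        has_integral_integrable[OF int]) auto
  also have "\<dots> = K / (2 * L) * exp (2 * L * t) - K / (2 * L)"
    using integral_unique[OF int] by simp
  also have "\<dots> \<le> K / (2 * L) * exp (2 * L * t)"
    using assms by simp
  finally have "exp (- (2 * L * t)) * norm (integral {0..t} g)
      \<le> exp (- (2 * L * t)) * (K / (2 * L) * exp (2 * L * t))"
    by (intro mult_left_mono) auto
  then show ?thesis by (simp add: exp_minus field_simps)
qed

text \<open>The Picard operator is a contraction for the norm that weights time \<open>t\<close> by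
  \<open>exp (- 2 L t)\<close>; \<open>z\<close> below is the weighted displacement from \<open>x0\<close>.\<close>

lemma lipschitz_ode_global_solution:
  fixes F :: "'a::banach \<Rightarrow> 'a"
  assumes lip: "L-lipschitz_on UNIV F" and "L > 0"
  obtains x where "x 0 = x0"
    "\<And>t. 0 \<le> t \<Longrightarrow> (x has_vector_derivative F (x t)) (at t within {0..})"
proof -
  define G where "G = (\<lambda>(z :: real \<Rightarrow>\<^sub>C 'a) s. F (x0 + exp (2 * L * s) *\<^sub>R apply_bcontfun z s))"
  \<comment> \<open>Bounded continuous functions live on the whole line, so \<open>max 0 t\<close>
    extends the displacement by its value 0 to negative times.\<close>
  define P where "P = (\<lambda>z t. exp (- (2 * L * max 0 t)) *\<^sub>R integral {0..max 0 t} (G z))"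
  have lipF: "norm (F u - F v) \<le> L * norm (u - v)" for u v
    using lipschitz_onD[OF lip, of u v] by (simp add: dist_norm)
  have contF: "continuous_on UNIV F"
    using lip by (rule lipschitz_on_continuous_on)
  have contG: "continuous_on A (G z)" for A z
    unfolding G_def
    by (intro continuous_on_compose2[OF contF] continuous_intros) auto
  have boundG: "norm (G z s) \<le> (norm (F x0) + L * norm z) * exp (2 * L * s)" if "0 \<le> s" for z s
  proof -
    have "norm (G z s) \<le> norm (F x0) + norm (G z s - F x0)"
      by norm
    also have "norm (G z s - F x0) \<le> L * (exp (2 * L * s) * norm (apply_bcontfun z s))"
      unfolding G_def using lipF[of "x0 + exp (2 * L * s) *\<^sub>R apply_bcontfun z s" x0] by simp
    also have "\<dots> \<le> L * (exp (2 * L * s) * norm z)"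
      using \<open>L > 0\<close> by (intro mult_left_mono norm_bounded) auto
    also have "norm (F x0) \<le> norm (F x0) * exp (2 * L * s)"
      using that \<open>L > 0\<close> by (intro mult_le_cancel_left1[THEN iffD2]) auto
    finally show ?thesis by (simp add: algebra_simps)
  qed
  have diffG: "norm (G z s - G w s) \<le> (L * dist z w) * exp (2 * L * s)" for z w s
  proof -
    have "norm (G z s - G w s) \<le> L * (exp (2 * L * s) * norm (apply_bcontfun z s - apply_bcontfun w s))"
      unfolding G_def
      using lipF[of "x0 + exp (2 * L * s) *\<^sub>R apply_bcontfun z s" "x0 + exp (2 * L * s) *\<^sub>R apply_bcontfun w s"]
      by (simp flip: scaleR_diff_right)
    also have "\<dots> \<le> L * (exp (2 * L * s) * dist z w)"
      using \<open>L > 0\<close> dist_bounded[of z s w] by (intro mult_left_mono) (auto simp: dist_norm)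
    finally show ?thesis by (simp add: algebra_simps)
  qed
  have integral_deriv: "((\<lambda>u. integral {0..u} (G z)) has_vector_derivative G z t) (at t within {0..})"
    if "0 \<le> t" for z t
  proof -
    have "((\<lambda>u. integral {0..u} (G z)) has_vector_derivative G z t) (at t within {0..t + 1})"
      by (rule integral_has_vector_derivative[OF contG]) (use that in auto)
    moreover have "at t within {0..t + 1} = at t within {0..}"
      by (rule at_within_nhd[of t "{..<t + 1}"]) auto
    ultimately show ?thesis by simp
  qed
  have bcont: "P z \<in> bcontfun" for z
  proof -
    have "continuous_on {0..} (\<lambda>u. integral {0..u} (G z))"
      using integral_deriv[of _ z]
      by (auto simp: continuous_on_eq_continuous_within intro: has_vector_derivative_continuous)
    then have "continuous_on UNIV (P z)"
      unfolding P_def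
      by (intro continuous_on_scaleR continuous_intros
          continuous_on_compose2[of "{0..}" "\<lambda>u. integral {0..u} (G z)" UNIV "max 0"]) auto
    moreover have "norm (P z t) \<le> (norm (F x0) + L * norm z) / (2 * L)" for t
      unfolding P_def using \<open>L > 0\<close> boundG[of _ z]
      by (intro weighted_integral_bound contG) auto
    ultimately show ?thesis
      by (auto simp: bcontfun_def bounded_iff)
  qed
  have P_diff: "dist (Bcontfun (P z)) (Bcontfun (P w)) \<le> 1 / 2 * dist z w" for z w
  proof (rule dist_bound)
    fix t
    have "integral {0..max 0 t} (G z) - integral {0..max 0 t} (G w)
        = integral {0..max 0 t} (\<lambda>s. G z s - G w s)"
      by (rule integral_diff[symmetric]) (intro integrable_continuous_real contG)+
    then have "norm (P z t - P w t)
        = norm (exp (- (2 * L * max 0 t)) *\<^sub>R integral {0..max 0 t} (\<lambda>s. G z s - G w s))"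
      unfolding P_def by (simp flip: scaleR_diff_right)
    also have "\<dots> \<le> (L * dist z w) / (2 * L)"
      using \<open>L > 0\<close> diffG[of z _ w]
      by (intro weighted_integral_bound continuous_on_diff contG) auto
    finally show "dist (apply_bcontfun (Bcontfun (P z)) t) (apply_bcontfun (Bcontfun (P w)) t)
        \<le> 1 / 2 * dist z w"
      using \<open>L > 0\<close> by (simp add: Bcontfun_inverse[OF bcont] dist_norm)
  qed
  obtain z where z: "Bcontfun (P z) = z"
    using banach_fix_type[of "1 / 2" "\<lambda>z. Bcontfun (P z)"] P_diff by auto
  have zP: "apply_bcontfun z t = P z t" for t
    using Bcontfun_inverse[OF bcont[of z]] by (simp add: z)
  define x where "x = (\<lambda>t. x0 + exp (2 * L * t) *\<^sub>R apply_bcontfun z t)"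
  have x: "x t = x0 + integral {0..t} (G z)" if "0 \<le> t" for t
    unfolding x_def zP P_def using that by (simp add: max_absorb2 exp_minus)
  show ?thesis
  proof (rule that[of x])
    show "x 0 = x0" using x[of 0] by simp
    fix t :: real assume t: "0 \<le> t"
    have "((\<lambda>u. x0 + integral {0..u} (G z)) has_vector_derivative 0 + G z t) (at t within {0..})"
      by (intro has_vector_derivative_add integral_deriv t has_vector_derivative_const)
    then have "(x has_vector_derivative G z t) (at t within {0..})"
      using t x by (auto intro: has_vector_derivative_transform[of t "{0..}"])
    moreover have "G z t = F (x t)" by (simp add: G_def x_def)
    ultimately show "(x has_vector_derivative F (x t)) (at t within {0..})" by simp
  qed
qed

subsection \<open>Bounded Lipschitz functions\<close>

text \<open>Boundedness is included because Lipschitz functions alone are not closed under products,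
  and the vector field is built from products of a rate with coordinates.\<close>

definition bounded_lipschitz :: "('a::metric_space \<Rightarrow> real) \<Rightarrow> bool" where
  "bounded_lipschitz f \<longleftrightarrow> bounded (range f) \<and> (\<exists>L. L-lipschitz_on UNIV f)"

lemma bounded_lipschitz_const: "bounded_lipschitz (\<lambda>x. c)"
  unfolding bounded_lipschitz_def by (auto simp: image_def intro: lipschitz_on_constant)

lemma bounded_lipschitz_add:
  assumes "bounded_lipschitz f" "bounded_lipschitz g"
  shows "bounded_lipschitz (\<lambda>x. f x + g x)"
  using assms unfolding bounded_lipschitz_def
  by (auto intro: lipschitz_on_add bounded_plus_comp)

lemma bounded_lipschitz_sum:
  assumes "\<And>i. i \<in> I \<Longrightarrow> bounded_lipschitz (f i)"
  shows "bounded_lipschitz (\<lambda>x. \<Sum>i\<in>I. f i x)"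
  using assms
  by (induction I rule: infinite_finite_induct)
    (auto intro: bounded_lipschitz_const bounded_lipschitz_add)

lemma bounded_lipschitz_mult:
  assumes "bounded_lipschitz f" "bounded_lipschitz g"
  shows "bounded_lipschitz (\<lambda>x. f x * g x)"
proof -
  obtain A B where AB: "\<And>x. \<bar>f x\<bar> \<le> A" "\<And>x. \<bar>g x\<bar> \<le> B"
    using assms unfolding bounded_lipschitz_def bounded_iff by auto
  obtain K L where KL: "K-lipschitz_on UNIV f" "L-lipschitz_on UNIV g"
    using assms unfolding bounded_lipschitz_def by auto
  have nonneg: "0 \<le> A" "0 \<le> B" "0 \<le> K" "0 \<le> L"
    using AB[of undefined] KL by (auto simp: lipschitz_on_def)
  have "dist (f x * g x) (f y * g y) \<le> (A * L + B * K) * dist x y" for x y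
  proof -
    have "f x * g x - f y * g y = f x * (g x - g y) + g y * (f x - f y)"
      by (simp add: algebra_simps)
    then have "dist (f x * g x) (f y * g y) \<le> \<bar>f x\<bar> * dist (g x) (g y) + \<bar>g y\<bar> * dist (f x) (f y)"
      by (metis abs_mult abs_triangle_ineq dist_real_def)
    also have "\<dots> \<le> A * (L * dist x y) + B * (K * dist x y)"
      using AB nonneg lipschitz_onD[OF KL(1), of x y] lipschitz_onD[OF KL(2), of x y]
      by (intro add_mono mult_mono) auto
    finally show ?thesis by (simp add: algebra_simps)
  qed
  then have "(A * L + B * K)-lipschitz_on UNIV (\<lambda>x. f x * g x)"
    using nonneg by (auto intro: lipschitz_onI)
  moreover have "bounded (range (\<lambda>x. f x * g x))"
    unfolding bounded_iff
    using AB nonneg by (auto simp: abs_mult intro!: exI[of _ "A * B"] mult_mono)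
  ultimately show ?thesis unfolding bounded_lipschitz_def by blast
qed

lemma bounded_lipschitz_compose:
  assumes "bounded_lipschitz f" "bounded_lipschitz g"
  shows "bounded_lipschitz (\<lambda>x. f (g x))"
proof -
  obtain K L where "K-lipschitz_on UNIV f" "L-lipschitz_on UNIV g"
    using assms unfolding bounded_lipschitz_def by auto
  then have "(K * L)-lipschitz_on UNIV (f \<circ> g)"
    by (intro lipschitz_on_compose) (auto intro: lipschitz_on_subset)
  moreover have "bounded (range (\<lambda>x. f (g x)))"
    using assms(1) unfolding bounded_lipschitz_def by (auto intro: bounded_subset)
  ultimately show ?thesis unfolding bounded_lipschitz_def comp_def by blast
qed

definition clamp01 :: "real \<Rightarrow> real" where
  "clamp01 a = max 0 (min 1 a)"

lemma clamp01_nonneg: "0 \<le> clamp01 a"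
  and clamp01_nonpos: "a \<le> 0 \<Longrightarrow> clamp01 a = 0"
  and clamp01_id: "0 \<le> a \<Longrightarrow> a \<le> 1 \<Longrightarrow> clamp01 a = a"
  and dist_clamp01: "dist (clamp01 a) (clamp01 b) \<le> dist a b"
  by (auto simp: clamp01_def dist_real_def)

section \<open>Vectors indexed by states as a Banach space\<close>

instance bcontfun :: (metric_space, banach) banach ..

text \<open>The number of states depends on the variable \<open>C\<close>, so no fixed finite type
  can index the coordinates. On a discrete space every bounded function is continuous, so this is
  the Banach space of bounded functions on all pairs with the supremum norm.\<close>

type_synonym state_vector = "(nat \<times> nat) discrete \<Rightarrow>\<^sub>C real"

definition coord :: "state_vector \<Rightarrow> nat \<times> nat \<Rightarrow> real" where
  "coord v z = apply_bcontfun v (discrete z)"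

definition state_vector :: "(nat \<times> nat \<Rightarrow> real) \<Rightarrow> state_vector" where
  "state_vector g = Bcontfun (\<lambda>z. g (of_discrete z))"

lemma coord_state_vector:
  assumes "finite A" "\<And>z. z \<notin> A \<Longrightarrow> g z = 0"
  shows "coord (state_vector g) z = g z"
proof -
  have "range (\<lambda>z. g (of_discrete z)) \<subseteq> insert 0 (g ` A)" using assms(2) by blast
  then have "finite (range (\<lambda>z. g (of_discrete z)))"
    by (rule finite_subset) (simp add: assms(1))
  then have "(\<lambda>z. g (of_discrete z)) \<in> bcontfun"
    by (auto simp: bcontfun_def finite_imp_bounded continuous_on_open_vimage Discrete_Topology.open_discrete)
  then show ?thesis
    by (simp add: coord_def state_vector_def Bcontfun_inverse discrete_inverse)
qed

lemma dist_coord_le: "dist (coord v z) (coord w z) \<le> dist v w"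
  unfolding coord_def by (rule dist_bounded)

lemma dist_state_vector_le:
  assumes "\<And>z. dist (coord v z) (coord w z) \<le> b"
  shows "dist v w \<le> b"
proof (rule dist_bound)
  fix z
  show "dist (apply_bcontfun v z) (apply_bcontfun w z) \<le> b"
    using assms[of "of_discrete z"] by (simp add: coord_def of_discrete_inverse)
qed

lemma bounded_linear_coord: "bounded_linear (\<lambda>v. coord v z)"
  unfolding coord_def by (rule bounded_linear_intro[where K = 1]) (auto simp flip: real_norm_def intro: norm_bounded)

section \<open>Masses of free and full states, and distributions from densities\<close>

lemma free_states_subset: "free_states C \<subseteq> states C"
  and full_states_subset: "full_states C \<subseteq> states C"
  by (auto simp: free_states_def states_def full_states_def)

lemma finite_free_states [simp]: "finite (free_states C)"
  and finite_full_states [simp]: "finite (full_states C)"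
  by (simp_all add: finite_subset[OF free_states_subset] finite_subset[OF full_states_subset])

lemma prob_free_states: "measure_pmf.prob p (free_states C) = (\<Sum>z\<in>free_states C. pmf p z)"
  and prob_full_states: "measure_pmf.prob p (full_states C) = (\<Sum>z\<in>full_states C. pmf p z)"
  by (simp_all add: measure_measure_pmf_finite)

lemma sum_states_split:
  fixes f :: "nat \<times> nat \<Rightarrow> real"
  shows "(\<Sum>z\<in>states C. f z) = (\<Sum>z\<in>full_states C. f z) + (\<Sum>z\<in>free_states C. f z)"
  unfolding full_states_def
  using sum.subset_diff[OF free_states_subset finite_states] by blast

lemma sum_pmf_states: "p \<in> distributions C \<Longrightarrow> (\<Sum>z\<in>states C. pmf p z) = 1"
  by (auto simp: distributions_def intro: sum_pmf_eq_1)

lemma prob_full_states_eq: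
  "p \<in> distributions C \<Longrightarrow> measure_pmf.prob p (full_states C) = 1 - measure_pmf.prob p (free_states C)"
  using sum_pmf_states[of p C] sum_states_split[of "pmf p" C]
  by (simp add: prob_free_states prob_full_states)

lemma distributions_eqI:
  assumes "p \<in> distributions C" "q \<in> distributions C" "\<And>z. z \<in> states C \<Longrightarrow> pmf p z = pmf q z"
  shows "p = q"
proof (rule pmf_eqI)
  fix z
  show "pmf p z = pmf q z"
  proof (cases "z \<in> states C")
    case False
    then have "z \<notin> set_pmf p" "z \<notin> set_pmf q"
      using assms by (auto simp: distributions_def)
    then show ?thesis by (metis pmf_eq_0_set_pmf)
  qed (rule assms)
qed

lemma distribution_of_density:
  assumes nonneg: "\<And>z. z \<in> states C \<Longrightarrow> 0 \<le> u z" and "(\<Sum>z\<in>states C. u z) = 1"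
  shows "\<exists>p\<in>distributions C. \<forall>z\<in>states C. pmf p z = u z"
proof -
  define g where "g = (\<lambda>z. if z \<in> states C then u z else 0)"
  have "(\<integral>\<^sup>+x. ennreal (g x) \<partial>count_space UNIV) = (\<Sum>x\<in>states C. ennreal (g x))"
    by (intro nn_integral_count_space'[of "states C"]) (auto simp: g_def)
  also have "\<dots> = ennreal (\<Sum>x\<in>states C. g x)"
    by (rule sum_ennreal) (auto simp: g_def nonneg)
  also have "(\<Sum>x\<in>states C. g x) = 1"
    using assms(2) by (simp add: g_def)
  finally have "pmf (embed_pmf g) z = g z" for z
    by (intro pmf_embed_pmf) (auto simp: g_def nonneg)
  then show ?thesis
    by (intro bexI[of _ "embed_pmf g"]) (auto simp: g_def distributions_def set_pmf_eq split: if_splits)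
qed

subsection \<open>Trajectories in the simplex\<close>

definition generator :: "nat \<Rightarrow> real \<Rightarrow> real \<Rightarrow> real \<Rightarrow> real \<Rightarrow> (nat \<times> nat \<Rightarrow> real) \<Rightarrow> nat \<times> nat \<Rightarrow> real"
  where "generator C l \<mu>\<^sub>1 \<mu>\<^sub>2 r f z =
     l * (nabla1_plus f z * indicator (free_states C) z)
   + \<mu>\<^sub>1 * (real (fst z) * nabla1_minus f z)
   + l * r * (nabla2_plus f z * indicator (free_states C) z)
   + \<mu>\<^sub>2 * (real (snd z) * nabla2_minus f z)"

lemma drift_eq_generator:
  "drift C l \<mu>\<^sub>1 \<mu>\<^sub>2 r p f = (\<Sum>z\<in>states C. generator C l \<mu>\<^sub>1 \<mu>\<^sub>2 r f z * pmf p z)"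
  unfolding drift_def pairing_def generator_def
  by (simp add: sum_distrib_left sum.distrib[symmetric] algebra_simps)

lemma generator_change_rate:
  "generator C l \<mu>\<^sub>1 \<mu>\<^sub>2 r f z = generator C l \<mu>\<^sub>1 \<mu>\<^sub>2 s f z
     + l * (r - s) * (nabla2_plus f z * indicator (free_states C) z)"
  by (simp add: generator_def algebra_simps)

text \<open>Jumps out of \<open>states C\<close> carry the factor 0, and truncated subtraction at 0
  returns the state itself, so only values on \<open>states C\<close> enter.\<close>

lemma generator_cong:
  assumes "z \<in> states C" "\<And>w. w \<in> states C \<Longrightarrow> f w = g w"
  shows "generator C l \<mu>\<^sub>1 \<mu>\<^sub>2 r f z = generator C l \<mu>\<^sub>1 \<mu>\<^sub>2 r g z"
proof -
  obtain x y where z: "z = (x, y)" by (cases z)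
  have "f (x, y) = g (x, y)" "f (x - 1, y) = g (x - 1, y)" "f (x, y - 1) = g (x, y - 1)"
    "(x, y) \<in> free_states C \<Longrightarrow> f (x + 1, y) = g (x + 1, y)"
    "(x, y) \<in> free_states C \<Longrightarrow> f (x, y + 1) = g (x, y + 1)"
    using assms(1) by (auto intro!: assms(2) simp: z states_def free_states_def)
  then show ?thesis
    by (cases "(x, y) \<in> free_states C")
      (auto simp: generator_def z nabla1_plus_def nabla1_minus_def nabla2_plus_def nabla2_minus_def)
qed

lemma generator_sum:
  "generator C l \<mu>\<^sub>1 \<mu>\<^sub>2 r (\<lambda>v. \<Sum>w\<in>S. c w * f w v) z
     = (\<Sum>w\<in>S. c w * generator C l \<mu>\<^sub>1 \<mu>\<^sub>2 r (f w) z)"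
  unfolding generator_def nabla1_plus_def nabla1_minus_def nabla2_plus_def nabla2_minus_def
  by (simp add: split_beta sum_distrib_left sum_distrib_right sum.distrib[symmetric]
      sum_subtractf[symmetric] algebra_simps)

lemma generator_expand:
  assumes "z \<in> states C"
  shows "generator C l \<mu>\<^sub>1 \<mu>\<^sub>2 r f z
    = (\<Sum>w\<in>states C. f w * generator C l \<mu>\<^sub>1 \<mu>\<^sub>2 r (indicator {w}) z)"
proof -
  have "f v = (\<Sum>w\<in>states C. f w * indicator {w} v)" if "v \<in> states C" for v
    using that by (simp add: indicator_def if_distrib[of "\<lambda>a. _ * a"] sum.delta' cong: if_cong)
  then show ?thesis
    unfolding generator_sum[symmetric] by (rule generator_cong[OF assms])
qed

text \<open>These are the off-diagonal entries of the rate matrix: the indicator vanishes at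
  \<open>w\<close>, so no increment from \<open>w\<close> is negative.\<close>

lemma generator_indicator_nonneg:
  assumes "0 \<le> l" "0 \<le> \<mu>\<^sub>1" "0 \<le> \<mu>\<^sub>2" "0 \<le> r" "w \<noteq> z"
  shows "0 \<le> generator C l \<mu>\<^sub>1 \<mu>\<^sub>2 r (indicator {z}) w"
  using assms unfolding generator_def
  by (cases w) (auto intro!: add_nonneg_nonneg mult_nonneg_nonneg
      simp: nabla1_plus_def nabla1_minus_def nabla2_plus_def nabla2_minus_def)

lemma generator_const: "generator C l \<mu>\<^sub>1 \<mu>\<^sub>2 r (\<lambda>_. 1) z = 0"
  by (simp add: generator_def nabla1_plus_def nabla1_minus_def nabla2_plus_def nabla2_minus_def split_beta)

text \<open>The forward equation in coordinates, obtained by testing with the indicator of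
  \<open>z\<close>. The rate enters as a function \<open>\<phi>\<close> of the clamped free mass so
  that the same field covers the linear and the nonlinear system.\<close>

definition clamped_field ::
    "nat \<Rightarrow> real \<Rightarrow> real \<Rightarrow> real \<Rightarrow> (real \<Rightarrow> real) \<Rightarrow> (nat \<times> nat \<Rightarrow> real) \<Rightarrow> nat \<times> nat \<Rightarrow> real" where
  "clamped_field C l \<mu>\<^sub>1 \<mu>\<^sub>2 \<phi> v z = (\<Sum>w\<in>states C.
     generator C l \<mu>\<^sub>1 \<mu>\<^sub>2 (\<phi> (\<Sum>u\<in>free_states C. clamp01 (v u))) (indicator {z}) w * clamp01 (v w))"

text \<open>Recovers the weak form, for arbitrary test functions, from the coordinate
  equations.\<close>

lemma sum_clamped_field:
  "(\<Sum>z\<in>states C. f z * clamped_field C l \<mu>\<^sub>1 \<mu>\<^sub>2 \<phi> v z) = (\<Sum>w\<in>states C.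
     generator C l \<mu>\<^sub>1 \<mu>\<^sub>2 (\<phi> (\<Sum>u\<in>free_states C. clamp01 (v u))) f w * clamp01 (v w))"
  (is "_ = (\<Sum>w\<in>states C. ?g f w * _)")
proof -
  have "(\<Sum>z\<in>states C. f z * clamped_field C l \<mu>\<^sub>1 \<mu>\<^sub>2 \<phi> v z)
      = (\<Sum>w\<in>states C. \<Sum>z\<in>states C. f z * ?g (indicator {z}) w * clamp01 (v w))"
    unfolding clamped_field_def sum_distrib_left mult.assoc by (rule sum.swap)
  also have "\<dots> = (\<Sum>w\<in>states C. ?g f w * clamp01 (v w))"
    by (rule sum.cong) (simp_all add: generator_expand[of _ C l \<mu>\<^sub>1 \<mu>\<^sub>2 _ f] sum_distrib_right)
  finally show ?thesis .
qed

lemma bounded_lipschitz_clamped_coord: "bounded_lipschitz (\<lambda>v. clamp01 (coord v z))"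
proof -
  have "1-lipschitz_on UNIV (\<lambda>v. clamp01 (coord v z))"
    by (rule lipschitz_onI) (auto intro: order_trans[OF dist_clamp01] dist_coord_le)
  moreover have "bounded (range (\<lambda>v. clamp01 (coord v z)))"
    unfolding bounded_iff by (auto simp: clamp01_def intro!: exI[of _ 1])
  ultimately show ?thesis unfolding bounded_lipschitz_def by blast
qed

lemma bounded_lipschitz_clamped_field:
  assumes "bounded_lipschitz \<phi>"
  shows "bounded_lipschitz (\<lambda>v. clamped_field C l \<mu>\<^sub>1 \<mu>\<^sub>2 \<phi> (coord v) z)"
  unfolding clamped_field_def generator_def
  by (intro bounded_lipschitz_sum bounded_lipschitz_mult bounded_lipschitz_add bounded_lipschitz_const
      bounded_lipschitz_clamped_coord bounded_lipschitz_compose[OF assms])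

text \<open>The clamping makes the vector field globally Lipschitz; it is invisible on the probability
  simplex. It also keeps the simplex invariant: where a coordinate is negative it has
  no outflow, so its derivative is nonnegative.\<close>

lemma clamped_solution_exists:
  assumes "0 \<le> l" "0 \<le> \<mu>\<^sub>1" "0 \<le> \<mu>\<^sub>2" and \<phi>_nonneg: "\<And>a. 0 \<le> \<phi> a" and \<phi>: "bounded_lipschitz \<phi>"
    and p: "p \<in> distributions C"
  obtains \<Lambda> where "\<Lambda> 0 = p" "\<And>t. 0 \<le> t \<Longrightarrow> \<Lambda> t \<in> distributions C"
    "\<And>t f. 0 \<le> t \<Longrightarrow> ((\<lambda>s. pairing C (\<Lambda> s) f) has_real_derivative
       drift C l \<mu>\<^sub>1 \<mu>\<^sub>2 (\<phi> (measure_pmf.prob (\<Lambda> t) (free_states C))) (\<Lambda> t) f) (at t within {0..})"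
proof -
  define \<Phi> where "\<Phi> = clamped_field C l \<mu>\<^sub>1 \<mu>\<^sub>2 \<phi>"
  define V where "V = (\<lambda>v. state_vector (\<lambda>z. if z \<in> states C then \<Phi> (coord v) z else 0))"
  have V: "coord (V v) z = (if z \<in> states C then \<Phi> (coord v) z else 0)" for v z
    unfolding V_def by (subst coord_state_vector[of "states C"]) auto
  have "\<exists>L. \<forall>z. (L z)-lipschitz_on UNIV (\<lambda>v. \<Phi> (coord v) z)"
    using bounded_lipschitz_clamped_field[OF \<phi>] unfolding \<Phi>_def bounded_lipschitz_def by metis
  then obtain L where L: "\<And>z. (L z)-lipschitz_on UNIV (\<lambda>v. \<Phi> (coord v) z)"
    by blast
  have L_nonneg: "0 \<le> L z" for z using L by (auto simp: lipschitz_on_def)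
  define K where "K = 1 + (\<Sum>z\<in>states C. L z)"
  have "K > 0" unfolding K_def using L_nonneg by (intro add_pos_nonneg sum_nonneg) auto
  have lipV: "K-lipschitz_on UNIV V"
  proof (rule lipschitz_onI)
    fix v w
    show "dist (V v) (V w) \<le> K * dist v w"
    proof (rule dist_state_vector_le)
      fix z
      have "dist (\<Phi> (coord v) z) (\<Phi> (coord w) z) \<le> K * dist v w" if "z \<in> states C"
      proof -
        have "L z \<le> K"
          unfolding K_def using that L_nonneg member_le_sum[of z "states C" L] by force
        then show ?thesis
          using lipschitz_onD[OF L, of v w z] by (smt (verit) UNIV_I mult_right_mono zero_le_dist)
      qed
      then show "dist (coord (V v) z) (coord (V w) z) \<le> K * dist v w"
        using \<open>K > 0\<close> by (simp add: V)
    qed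
  qed (use \<open>K > 0\<close> in simp)
  obtain x where x0: "x 0 = state_vector (pmf p)"
    and x: "\<And>t. 0 \<le> t \<Longrightarrow> (x has_vector_derivative V (x t)) (at t within {0..})"
    using lipschitz_ode_global_solution[OF lipV \<open>K > 0\<close>, of "state_vector (pmf p)"] by metis
  define X where "X = (\<lambda>t. coord (x t))"
  have X0: "X 0 z = pmf p z" for z
    unfolding X_def x0 using p
    by (subst coord_state_vector[of "states C"]) (auto simp: distributions_def pmf_eq_0_set_pmf)
  have derX: "((\<lambda>s. X s z) has_real_derivative \<Phi> (X t) z) (at t within {0..})"
    if "0 \<le> t" "z \<in> states C" for t z
    using bounded_linear.has_vector_derivative[OF bounded_linear_coord x[OF that(1)], of z] that V[of "x t" z]
    by (simp add: X_def has_real_derivative_iff_has_vector_derivative)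
  have X_nonneg: "0 \<le> X t z" if "0 \<le> t" "z \<in> states C" for t z
  proof -
    have "- X t z \<le> 0"
    \<comment> \<open>The derivative has the right sign for every positive value of
      \<open>- X t z\<close>, so the upper level 1 is arbitrary.\<close>
    proof (rule derivative_barrier[where a = 0 and b = 1 and g = "\<lambda>t. - X t z" and g' = "\<lambda>t. - \<Phi> (X t) z"])
      fix s assume s: "0 \<le> (s::real)"
      show "((\<lambda>t. - X t z) has_real_derivative - \<Phi> (X s) z) (at s within {0..})"
        by (rule DERIV_minus[OF derX[OF s that(2)]])
      assume "0 < - X s z"
      then have "clamp01 (X s z) = 0" by (intro clamp01_nonpos) simp
      then show "- \<Phi> (X s) z \<le> 0"
        unfolding \<Phi>_def clamped_field_def neg_le_0_iff_le
      proof (intro sum_nonneg)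
        fix w
        show "0 \<le> generator C l \<mu>\<^sub>1 \<mu>\<^sub>2 (\<phi> (\<Sum>u\<in>free_states C. clamp01 (X s u))) (indicator {z}) w
            * clamp01 (X s w)"
          using \<open>clamp01 (X s z) = 0\<close> assms clamp01_nonneg
          by (cases "w = z") (auto intro!: mult_nonneg_nonneg generator_indicator_nonneg)
      qed
    qed (use X0 that in auto)
    then show ?thesis by simp
  qed
  have derF: "((\<lambda>s. \<Sum>z\<in>states C. f z * X s z) has_real_derivative
      (\<Sum>w\<in>states C. generator C l \<mu>\<^sub>1 \<mu>\<^sub>2 (\<phi> (\<Sum>u\<in>free_states C. clamp01 (X t u))) f w
        * clamp01 (X t w))) (at t within {0..})" if "0 \<le> t" for f t
    unfolding sum_clamped_field[symmetric] \<Phi>_def[symmetric]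
    by (intro DERIV_sum DERIV_cmult derX that)
  have X_sum: "(\<Sum>z\<in>states C. X t z) = 1" if "0 \<le> t" for t
  proof -
    have "\<exists>c. \<forall>s\<in>{0..}. (\<Sum>z\<in>states C. X s z) = c"
      by (rule has_field_derivative_zero_constant)
        (use derF[where f = "\<lambda>_. 1"] in \<open>auto simp: generator_const\<close>)
    moreover have "(\<Sum>z\<in>states C. X 0 z) = 1"
      by (simp add: X0 sum_pmf_states[OF p])
    ultimately show ?thesis using that by force
  qed
  \<comment> \<open>Nonnegative coordinates with sum 1 lie in the unit interval, so from here on the
    clamps disappear.\<close>
  have clampX: "clamp01 (X t z) = X t z" if "0 \<le> t" "z \<in> states C" for t z
    using X_nonneg[OF that(1)] X_sum[OF that(1)] member_le_sum[of z "states C" "X t"] that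
    by (intro clamp01_id) auto
  have "\<exists>q. 0 \<le> t \<longrightarrow> q \<in> distributions C \<and> (\<forall>z\<in>states C. pmf q z = X t z)" for t
    using distribution_of_density[of C "X t"] X_nonneg X_sum by blast
  then obtain \<Lambda> where \<Lambda>: "\<And>t. 0 \<le> t \<Longrightarrow> \<Lambda> t \<in> distributions C"
    "\<And>t z. 0 \<le> t \<Longrightarrow> z \<in> states C \<Longrightarrow> pmf (\<Lambda> t) z = X t z"
    by metis
  show ?thesis
  proof (rule that[of \<Lambda>])
    show "\<Lambda> 0 = p"
      by (rule distributions_eqI[OF \<Lambda>(1) p]) (simp_all add: \<Lambda>(2) X0)
    fix t f assume t: "0 \<le> (t::real)"
    have "(\<Sum>u\<in>free_states C. clamp01 (X t u)) = measure_pmf.prob (\<Lambda> t) (free_states C)"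
      unfolding prob_free_states
      by (intro sum.cong refl) (metis clampX \<Lambda>(2) t free_states_subset subsetD)
    then have "((\<lambda>s. \<Sum>z\<in>states C. f z * X s z) has_real_derivative
        drift C l \<mu>\<^sub>1 \<mu>\<^sub>2 (\<phi> (measure_pmf.prob (\<Lambda> t) (free_states C))) (\<Lambda> t) f) (at t within {0..})"
      using derF[OF t, of f] by (simp add: drift_eq_generator clampX \<Lambda>(2) t)
    then show "((\<lambda>s. pairing C (\<Lambda> s) f) has_real_derivative
        drift C l \<mu>\<^sub>1 \<mu>\<^sub>2 (\<phi> (measure_pmf.prob (\<Lambda> t) (free_states C))) (\<Lambda> t) f) (at t within {0..})"
      by (rule has_field_derivative_transform_within[where d = 1]) (auto simp: pairing_def \<Lambda>(2) t)
  qed (rule \<Lambda>(1))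
qed

subsection \<open>Estimates for the norm\<close>

lemma drift_expand:
  "drift C l \<mu>\<^sub>1 \<mu>\<^sub>2 r p f
    = (\<Sum>z\<in>states C. f z * drift C l \<mu>\<^sub>1 \<mu>\<^sub>2 r p (indicator {z}))"
proof -
  have "drift C l \<mu>\<^sub>1 \<mu>\<^sub>2 r p f = (\<Sum>w\<in>states C. \<Sum>z\<in>states C.
      f z * generator C l \<mu>\<^sub>1 \<mu>\<^sub>2 r (indicator {z}) w * pmf p w)"
    unfolding drift_eq_generator
    by (rule sum.cong) (simp_all add: generator_expand[of _ C l \<mu>\<^sub>1 \<mu>\<^sub>2 r f] sum_distrib_right)
  also have "\<dots> = (\<Sum>z\<in>states C. f z * drift C l \<mu>\<^sub>1 \<mu>\<^sub>2 r p (indicator {z}))"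
    unfolding drift_eq_generator sum_distrib_left mult.assoc by (rule sum.swap)
  finally show ?thesis .
qed

lemma norm2_power2: "(norm2 C p q)\<^sup>2 = (\<Sum>z\<in>states C. (pmf p z - pmf q z)\<^sup>2 / pmf q z)"
  unfolding norm2_def by (intro real_sqrt_pow2 sum_nonneg) auto

lemma norm2_nonneg: "0 \<le> norm2 C p q"
  unfolding norm2_def by (intro real_sqrt_ge_zero sum_nonneg) auto

text \<open>The test function itself depends on \<open>\<Lambda> t\<close>, so the hypothesis is
  applied only to indicators. This differentiates each coordinate; the chain rule and the expansion
  of the drift in indicators then reassemble the sum, with the density frozen at time
  \<open>t\<close>.\<close>

lemma norm2_power2_derivative:
  assumes der: "\<And>f. ((\<lambda>s. pairing C (\<Lambda> s) f) has_real_derivative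
      drift C l \<mu>\<^sub>1 \<mu>\<^sub>2 r (\<Lambda> t) f) (at t within {0..})"
  shows "((\<lambda>s. (norm2 C (\<Lambda> s) q)\<^sup>2) has_real_derivative
      drift C l \<mu>\<^sub>1 \<mu>\<^sub>2 r (\<Lambda> t) (\<lambda>z. 2 * ((pmf (\<Lambda> t) z - pmf q z) / pmf q z))) (at t within {0..})"
proof -
  have "pairing C p (indicator {z}) = pmf p z" if "z \<in> states C" for p z
    using that by (simp add: pairing_def indicator_def if_distrib[of "\<lambda>a. a * _"] sum.delta cong: if_cong)
  then have "((\<lambda>s. pmf (\<Lambda> s) z) has_real_derivative
      drift C l \<mu>\<^sub>1 \<mu>\<^sub>2 r (\<Lambda> t) (indicator {z})) (at t within {0..})" if "z \<in> states C" for z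
    using der[of "indicator {z}"] that by simp
  then have "((\<lambda>s. (pmf (\<Lambda> s) z - pmf q z)\<^sup>2 / pmf q z) has_real_derivative
      2 * ((pmf (\<Lambda> t) z - pmf q z) / pmf q z) * drift C l \<mu>\<^sub>1 \<mu>\<^sub>2 r (\<Lambda> t) (indicator {z}))
      (at t within {0..})" if "z \<in> states C" for z
    using DERIV_cdivide[OF DERIV_power[OF DERIV_diff[OF _ DERIV_const]], of "\<lambda>s. pmf (\<Lambda> s) z"
        _ t "{0..}" "pmf q z" 2 "pmf q z"] that
    by (simp add: mult_ac)
  then show ?thesis
    unfolding norm2_power2 drift_expand[of C l \<mu>\<^sub>1 \<mu>\<^sub>2 r _ "\<lambda>z. 2 * _ z"]
    by (intro DERIV_sum) auto
qed

lemma weighted_Cauchy_Schwarz_sum: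
  fixes w f g :: "'a \<Rightarrow> real"
  assumes "\<And>z. z \<in> S \<Longrightarrow> 0 \<le> w z"
  shows "(\<Sum>z\<in>S. w z * (f z * g z))\<^sup>2 \<le> (\<Sum>z\<in>S. w z * (f z)\<^sup>2) * (\<Sum>z\<in>S. w z * (g z)\<^sup>2)"
proof -
  have "(\<Sum>z\<in>S. (sqrt (w z) * f z) * (sqrt (w z) * g z))\<^sup>2
      \<le> (\<Sum>z\<in>S. (sqrt (w z) * f z)\<^sup>2) * (\<Sum>z\<in>S. (sqrt (w z) * g z)\<^sup>2)"
    by (rule Cauchy_Schwarz_ineq_sum)
  moreover have "(sqrt (w z) * f z) * (sqrt (w z) * g z) = w z * (f z * g z)"
      "(sqrt (w z) * f z)\<^sup>2 = w z * (f z)\<^sup>2" "(sqrt (w z) * g z)\<^sup>2 = w z * (g z)\<^sup>2"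
    if "z \<in> S" for z
    using real_sqrt_mult_self[of "w z"] assms[OF that]
    by (simp_all add: power_mult_distrib)
  ultimately show ?thesis by (simp cong: sum.cong)
qed

lemma sum_free_indicator:
  "(\<Sum>z\<in>states C. indicator (free_states C) z * f z) = (\<Sum>z\<in>free_states C. f z :: real)"
  using sum.inter_restrict[OF finite_states, of f C "free_states C"] free_states_subset[of C]
  by (simp add: indicator_def if_distrib[of "\<lambda>a. a * _"] Int_absorb1 cong: if_cong)

text \<open>Raising the second coordinate by one maps the free states bijectively onto the states
  where it is nonzero; the others contribute 0 on the left.\<close>

lemma sum_balance_snd:
  fixes \<pi> \<phi> :: "nat \<times> nat \<Rightarrow> real"
  assumes balance: "\<And>x y. x + y < C \<Longrightarrow> real (y + 1) * \<pi> (x, y + 1) = c * \<pi> (x, y)"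
  shows "(\<Sum>z\<in>states C. real (snd z) * \<pi> z * \<phi> z)
    = c * (\<Sum>z\<in>free_states C. \<pi> z * \<phi> (fst z, snd z + 1))"
proof -
  define up where "up = (\<lambda>z :: nat \<times> nat. (fst z, snd z + 1))"
  have up: "bij_betw up (free_states C) {z \<in> states C. snd z \<noteq> 0}"
    by (rule bij_betwI[where g = "\<lambda>z. (fst z, snd z - 1)"])
      (auto simp: up_def free_states_def states_def)
  have "(\<Sum>z\<in>states C. real (snd z) * \<pi> z * \<phi> z)
      = (\<Sum>z\<in>{z \<in> states C. snd z \<noteq> 0}. real (snd z) * \<pi> z * \<phi> z)"
    by (rule sum.mono_neutral_right) auto
  also have "\<dots> = (\<Sum>z\<in>free_states C. real (snd (up z)) * \<pi> (up z) * \<phi> (up z))"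
    by (rule sum.reindex_bij_betw[OF up, symmetric])
  also have "\<dots> = (\<Sum>z\<in>free_states C. c * (\<pi> z * \<phi> (fst z, snd z + 1)))"
    using balance by (intro sum.cong) (auto simp: up_def free_states_def)
  finally show ?thesis by (simp add: sum_distrib_left)
qed

text \<open>Since \<open>h\<close> is centred, the indicator of the free states may be replaced by
  its deviation from its mean \<open>1 - R\<close>. This deviation has the Bernoulli variance
  \<open>R * (1 - R)\<close>, and Cauchy-Schwarz concludes.\<close>

lemma free_mass_deviation_bound:
  fixes \<pi> h :: "nat \<times> nat \<Rightarrow> real"
  assumes nonneg: "\<And>z. z \<in> states C \<Longrightarrow> 0 \<le> \<pi> z" and total: "(\<Sum>z\<in>states C. \<pi> z) = 1"
    and R: "R = (\<Sum>z\<in>full_states C. \<pi> z)" and centred: "(\<Sum>z\<in>states C. \<pi> z * h z) = 0"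
  shows "(\<Sum>z\<in>free_states C. \<pi> z * h z)\<^sup>2 \<le> R * (1 - R) * (\<Sum>z\<in>states C. \<pi> z * (h z)\<^sup>2)"
proof -
  let ?I = "\<lambda>z. indicator (free_states C) z :: real"
  have free: "(\<Sum>z\<in>free_states C. \<pi> z) = 1 - R"
    using sum_states_split[of \<pi> C] total R by simp
  have "(\<Sum>z\<in>states C. \<pi> z * (h z * (?I z - (1 - R))))
      = (\<Sum>z\<in>states C. ?I z * (\<pi> z * h z)) - (1 - R) * (\<Sum>z\<in>states C. \<pi> z * h z)"
    unfolding sum_distrib_left sum_subtractf[symmetric] by (rule sum.cong) (auto simp: algebra_simps)
  then have "(\<Sum>z\<in>free_states C. \<pi> z * h z) = (\<Sum>z\<in>states C. \<pi> z * (h z * (?I z - (1 - R))))"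
    by (simp add: sum_free_indicator centred)
  moreover have "(\<Sum>z\<in>states C. \<pi> z * (?I z - (1 - R))\<^sup>2)
      = (1 - 2 * (1 - R)) * (\<Sum>z\<in>states C. ?I z * \<pi> z) + (1 - R)\<^sup>2 * (\<Sum>z\<in>states C. \<pi> z)"
    unfolding sum_distrib_left sum.distrib[symmetric]
    by (rule sum.cong) (auto simp: indicator_def algebra_simps power2_eq_square)
  then have "(\<Sum>z\<in>states C. \<pi> z * (?I z - (1 - R))\<^sup>2) = R * (1 - R)"
    by (simp add: sum_free_indicator free total) (simp add: algebra_simps power2_eq_square)
  ultimately show ?thesis
    using weighted_Cauchy_Schwarz_sum[of "states C" \<pi> h "\<lambda>z. ?I z - (1 - R)"] nonneg
    by (simp add: mult.commute)
qed

text \<open>By balance, the pairing of \<open>\<pi>\<close> with the increments of \<open>h\<close> equals the \<open>\<pi>\<close>-weighted inner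
  product of \<open>h\<close> with \<open>y / c - indicator\<close>. The variance of the latter is at most \<open>C / c\<close>.\<close>

lemma free_increment_bound:
  fixes \<pi> h :: "nat \<times> nat \<Rightarrow> real"
  assumes nonneg: "\<And>z. z \<in> states C \<Longrightarrow> 0 \<le> \<pi> z" and total: "(\<Sum>z\<in>states C. \<pi> z) = 1"
    and R: "R = (\<Sum>z\<in>full_states C. \<pi> z)" and "0 \<le> R" "R \<le> 1" "c > 0" "C \<ge> 1"
    and balance: "\<And>x y. x + y < C \<Longrightarrow> real (y + 1) * \<pi> (x, y + 1) = c * \<pi> (x, y)"
  shows "(\<Sum>z\<in>free_states C. \<pi> z * nabla2_plus h z)\<^sup>2 \<le> real C / c * (\<Sum>z\<in>states C. \<pi> z * (h z)\<^sup>2)"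
proof -
  let ?I = "\<lambda>z. indicator (free_states C) z :: real"
  let ?w = "\<lambda>z. real (snd z) / c - ?I z"
  note bal = sum_balance_snd[of C \<pi> c, OF balance]
  have free: "(\<Sum>z\<in>free_states C. \<pi> z) = 1 - R"
    using sum_states_split[of \<pi> C] total R by simp
  define Y where "Y = (\<Sum>z\<in>free_states C. \<pi> z * real (snd z))"
  \<comment> \<open>Balance with the constant function 1 shows that the second coordinate has mean
    \<open>c * (1 - R)\<close>. Full states carry at most \<open>C * R\<close> of it, which bounds
    the share \<open>Y\<close> of the free states from below.\<close>
  have "c * (1 - R) = (\<Sum>z\<in>states C. real (snd z) * \<pi> z)"
    using bal[of "\<lambda>_. 1"] by (simp add: free)
  also have "\<dots> = (\<Sum>z\<in>full_states C. real (snd z) * \<pi> z) + Y"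
    unfolding sum_states_split[of _ C] Y_def by (simp add: mult.commute)
  also have "(\<Sum>z\<in>full_states C. real (snd z) * \<pi> z) \<le> (\<Sum>z\<in>full_states C. real C * \<pi> z)"
    using nonneg by (intro sum_mono mult_right_mono) (auto simp: full_states_def states_def)
  also have "\<dots> = real C * R"
    by (simp add: R sum_distrib_left)
  finally have Y: "c * (1 - R) \<le> real C * R + Y" by simp
  have "(\<Sum>z\<in>states C. \<pi> z * (?w z)\<^sup>2) = (\<Sum>z\<in>states C. real (snd z) * \<pi> z * real (snd z)) / c\<^sup>2
      - 2 / c * (\<Sum>z\<in>states C. ?I z * (\<pi> z * real (snd z))) + (\<Sum>z\<in>states C. ?I z * \<pi> z)"
    unfolding sum_distrib_left sum_divide_distrib sum_subtractf[symmetric] sum.distrib[symmetric]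
    by (rule sum.cong) (auto simp: indicator_def algebra_simps power2_eq_square)
  also have "(\<Sum>z\<in>states C. real (snd z) * \<pi> z * real (snd z)) = c * (Y + (1 - R))"
    using bal[of "\<lambda>z. real (snd z)"] unfolding Y_def free[symmetric]
    by (simp add: algebra_simps sum.distrib)
  also have "(\<Sum>z\<in>states C. ?I z * (\<pi> z * real (snd z))) = Y"
    unfolding sum_free_indicator Y_def ..
  also have "(\<Sum>z\<in>states C. ?I z * \<pi> z) = 1 - R"
    unfolding sum_free_indicator free ..
  also have "c * (Y + (1 - R)) / c\<^sup>2 - 2 / c * Y + (1 - R) = (c * (1 - R) - Y + (1 - R)) / c"
    using \<open>c > 0\<close> by (simp add: field_simps power2_eq_square)
  also have "\<dots> \<le> real C / c"
  proof (rule divide_right_mono)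
    \<comment> \<open>The bound on \<open>Y\<close> leaves \<open>C * R + (1 - R)\<close>; here
      \<open>C \<ge> 1\<close> absorbs \<open>1 - R\<close> into \<open>C * (1 - R)\<close>.\<close>
    have "0 \<le> (real C - 1) * (1 - R)"
      using assms by (intro mult_nonneg_nonneg) auto
    then show "c * (1 - R) - Y + (1 - R) \<le> real C"
      using Y by (simp add: algebra_simps)
  qed (use \<open>c > 0\<close> in simp)
  finally have w: "(\<Sum>z\<in>states C. \<pi> z * (?w z)\<^sup>2) \<le> real C / c" .
  have "(\<Sum>z\<in>states C. \<pi> z * (h z * ?w z))
      = (\<Sum>z\<in>states C. real (snd z) * \<pi> z * h z) / c - (\<Sum>z\<in>states C. ?I z * (\<pi> z * h z))"
    unfolding sum_divide_distrib sum_subtractf[symmetric]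
    by (rule sum.cong) (auto simp: algebra_simps)
  also have "\<dots> = (\<Sum>z\<in>free_states C. \<pi> z * h (fst z, snd z + 1)) - (\<Sum>z\<in>free_states C. \<pi> z * h z)"
    using bal[of h] \<open>c > 0\<close> unfolding sum_free_indicator by simp
  also have "\<dots> = (\<Sum>z\<in>free_states C. \<pi> z * nabla2_plus h z)"
    unfolding sum_subtractf[symmetric]
    by (rule sum.cong) (auto simp: nabla2_plus_def algebra_simps split_beta)
  finally have "(\<Sum>z\<in>free_states C. \<pi> z * nabla2_plus h z)\<^sup>2
      \<le> (\<Sum>z\<in>states C. \<pi> z * (h z)\<^sup>2) * (\<Sum>z\<in>states C. \<pi> z * (?w z)\<^sup>2)"
    using weighted_Cauchy_Schwarz_sum[of "states C" \<pi> h ?w] nonneg by simp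
  also have "\<dots> \<le> (\<Sum>z\<in>states C. \<pi> z * (h z)\<^sup>2) * (real C / c)"
    using w nonneg by (intro mult_left_mono sum_nonneg) auto
  finally show ?thesis by (simp add: mult.commute)
qed

text \<open>The lower bound \<open>m\<close> on the weights turns the weighted norm into a pointwise
  bound on \<open>h\<close>. The constant is crude, which is harmless because this term only enters
  the cubic remainder.\<close>

lemma free_quadratic_increment_bound:
  fixes \<pi> h :: "nat \<times> nat \<Rightarrow> real"
  assumes pos: "\<And>z. z \<in> states C \<Longrightarrow> m \<le> \<pi> z" and "m > 0" and total: "(\<Sum>z\<in>states C. \<pi> z) = 1"
  shows "\<bar>\<Sum>z\<in>free_states C. \<pi> z * h z * nabla2_plus h z\<bar>
    \<le> 2 / m * (\<Sum>z\<in>states C. \<pi> z * (h z)\<^sup>2)"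
proof -
  define N where "N = (\<Sum>z\<in>states C. \<pi> z * (h z)\<^sup>2)"
  have nonneg: "0 \<le> \<pi> z" if "z \<in> states C" for z
    using pos[OF that] \<open>m > 0\<close> by simp
  have h2: "(h z)\<^sup>2 \<le> N / m" if "z \<in> states C" for z
  proof -
    have "m * (h z)\<^sup>2 \<le> \<pi> z * (h z)\<^sup>2"
      using pos[OF that] by (intro mult_right_mono) auto
    also have "\<dots> \<le> N"
      unfolding N_def using that nonneg by (intro member_le_sum) auto
    finally show ?thesis using \<open>m > 0\<close> by (simp add: field_simps)
  qed
  have step: "\<bar>\<pi> z * h z * nabla2_plus h z\<bar> \<le> \<pi> z * (2 / m * N)" if "z \<in> free_states C" for z
  proof -
    define z' where "z' = (fst z, snd z + 1)"
    have z: "z \<in> states C" "z' \<in> states C"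
      using that by (auto simp: z'_def free_states_def states_def)
    have "h z * nabla2_plus h z = h z * h z' - (h z)\<^sup>2"
      by (simp add: nabla2_plus_def z'_def split_beta algebra_simps power2_eq_square)
    moreover have "\<bar>h z * h z'\<bar> \<le> ((h z)\<^sup>2 + (h z')\<^sup>2) / 2"
      using sum_squares_bound[of "\<bar>h z\<bar>" "\<bar>h z'\<bar>"] by (simp add: abs_mult)
    ultimately have "\<bar>h z * nabla2_plus h z\<bar> \<le> 2 / m * N"
      using h2[OF z(1)] h2[OF z(2)] zero_le_power2[of "h z"] by (simp split: abs_split)
    from mult_left_mono[OF this nonneg[OF z(1)]] show ?thesis
      using nonneg[OF z(1)] by (simp add: abs_mult mult.assoc)
  qed
  have "0 \<le> N" unfolding N_def using nonneg by (intro sum_nonneg) auto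
  have "\<bar>\<Sum>z\<in>free_states C. \<pi> z * h z * nabla2_plus h z\<bar> \<le> (\<Sum>z\<in>free_states C. \<pi> z * (2 / m * N))"
    using step by (intro order_trans[OF sum_abs] sum_mono)
  also have "\<dots> = (\<Sum>z\<in>free_states C. \<pi> z) * (2 / m * N)"
    by (simp only: sum_distrib_right)
  also have "\<dots> \<le> 1 * (2 / m * N)"
  proof (rule mult_right_mono)
    show "(\<Sum>z\<in>free_states C. \<pi> z) \<le> 1"
      unfolding total[symmetric] using nonneg free_states_subset by (intro sum_mono2) auto
  qed (use \<open>0 \<le> N\<close> \<open>m > 0\<close> in simp)
  finally show ?thesis unfolding N_def[symmetric] by simp
qed

subsection \<open>Local decay and stability\<close>

lemma pmf_inv_dist_pos:
  assumes "\<rho>\<^sub>1 > 0" "\<rho>\<^sub>2 > 0" "0 < R" "R < 1" "z \<in> states C"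
  shows "0 < pmf (inv_dist C \<rho>\<^sub>1 \<rho>\<^sub>2 R) z"
  using inv_norm_pos[of \<rho>\<^sub>1 \<rho>\<^sub>2 R C] assms
  by (cases z) (auto simp: pmf_inv_dist inv_weight_def)

text \<open>Detailed balance between arrivals and departures in the second coordinate, divided by
  the departure rate \<open>\<mu>\<^sub>2\<close>.\<close>

lemma pmf_inv_dist_balance:
  assumes "\<rho>\<^sub>1 > 0" "\<rho>\<^sub>2 > 0" "0 < R" "R < 1" "x + y < C"
  shows "real (y + 1) * pmf (inv_dist C \<rho>\<^sub>1 \<rho>\<^sub>2 R) (x, y + 1)
    = \<rho>\<^sub>2 * (R / (1 - R)) * pmf (inv_dist C \<rho>\<^sub>1 \<rho>\<^sub>2 R) (x, y)"
proof -
  have "real (y + 1) * inv_weight \<rho>\<^sub>1 \<rho>\<^sub>2 R (x, y + 1) = \<rho>\<^sub>2 * (R / (1 - R)) * inv_weight \<rho>\<^sub>1 \<rho>\<^sub>2 R (x, y)"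
    using assms by (simp add: inv_weight_def field_simps del: of_nat_Suc)
  moreover have "(x, y + 1) \<in> states C" "(x, y) \<in> states C"
    using assms by (auto simp: states_def)
  ultimately show ?thesis
    using assms by (simp add: pmf_inv_dist)
qed

lemma norm2_eq_0_iff:
  assumes "p \<in> distributions C" "q \<in> distributions C" "\<And>z. z \<in> states C \<Longrightarrow> 0 < pmf q z"
  shows "norm2 C p q = 0 \<longleftrightarrow> p = q"
proof
  assume "norm2 C p q = 0"
  then have "(\<Sum>z\<in>states C. (pmf p z - pmf q z)\<^sup>2 / pmf q z) = 0"
    by (simp flip: norm2_power2)
  then have "\<forall>z\<in>states C. (pmf p z - pmf q z)\<^sup>2 / pmf q z = 0"
    by (subst (asm) sum_nonneg_eq_0_iff) auto
  then show "p = q"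
    using assms(3) by (intro distributions_eqI[OF assms(1,2)]) fastforce
qed (simp add: norm2_def)

lemma real_derivative_unique_within_nonneg:
  assumes "(f has_real_derivative a) (at 0 within {0..})" "(f has_real_derivative b) (at 0 within {0..})"
  shows "a = b"
  using assms unfolding has_real_derivative_iff_has_vector_derivative
  by (intro vector_derivative_unique_within[of 0 "{0..}" f]) (auto simp: at_within_Ici_at_right)

text \<open>The gap condition speaks about trajectories. Since every distribution is the initial value
  of a linear solution, it yields a pointwise inequality for the drift.\<close>

lemma gap_bound_drift_le:
  assumes "0 \<le> l" "0 \<le> \<mu>\<^sub>1" "0 \<le> \<mu>\<^sub>2" "0 < R" "R < 1" and gap: "gap_bound C l \<mu>\<^sub>1 \<mu>\<^sub>2 R k"
    and p: "p \<in> distributions C"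
  defines "q \<equiv> inv_dist C (l / \<mu>\<^sub>1) (l / \<mu>\<^sub>2) R"
  shows "drift C l \<mu>\<^sub>1 \<mu>\<^sub>2 (R / (1 - R)) p (\<lambda>z. 2 * ((pmf p z - pmf q z) / pmf q z))
    \<le> - (2 * k) * (norm2 C p q)\<^sup>2"
proof -
  have "0 \<le> R / (1 - R)" using assms by simp
  then obtain \<Lambda> where "\<Lambda> 0 = p" "\<And>t. 0 \<le> t \<Longrightarrow> \<Lambda> t \<in> distributions C"
    and der: "\<And>t f. 0 \<le> t \<Longrightarrow> ((\<lambda>s. pairing C (\<Lambda> s) f) has_real_derivative
       drift C l \<mu>\<^sub>1 \<mu>\<^sub>2 (R / (1 - R)) (\<Lambda> t) f) (at t within {0..})"
    using clamped_solution_exists[OF assms(1-3) _ bounded_lipschitz_const p, of "R / (1 - R)"] by metis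
  then have "linear_solution C l \<mu>\<^sub>1 \<mu>\<^sub>2 R \<Lambda>"
    by (simp add: linear_solution_def)
  then have "norm2_decay C q (2 * k) \<Lambda>"
    using gap by (simp add: gap_bound_def q_def)
  then obtain D where D: "((\<lambda>s. (norm2 C (\<Lambda> s) q)\<^sup>2) has_real_derivative D) (at 0 within {0..})"
    "D \<le> - (2 * k) * (norm2 C p q)\<^sup>2"
    unfolding norm2_decay_def using \<open>\<Lambda> 0 = p\<close> by auto
  moreover have "((\<lambda>s. (norm2 C (\<Lambda> s) q)\<^sup>2) has_real_derivative
      drift C l \<mu>\<^sub>1 \<mu>\<^sub>2 (R / (1 - R)) p (\<lambda>z. 2 * ((pmf p z - pmf q z) / pmf q z))) (at 0 within {0..})"
    using norm2_power2_derivative[OF der[OF order_refl], of q] \<open>\<Lambda> 0 = p\<close> by simp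
  ultimately show ?thesis
    using real_derivative_unique_within_nonneg by fastforce
qed

abbreviation free_ratio :: "nat \<Rightarrow> (nat \<times> nat) pmf \<Rightarrow> real" where
  "free_ratio C p \<equiv> measure_pmf.prob p (full_states C) / measure_pmf.prob p (free_states C)"

text \<open>As \<open>p\<close> is \<open>q\<close> times \<open>1 + h\<close> on the states, the
  change of rate adds exactly \<open>- 2 * l * \<delta> * (W + Q) / ((1 - R) * a)\<close>, where
  \<open>W\<close> averages the increments of \<open>h\<close> under \<open>q\<close> and
  \<open>Q\<close> carries the extra factor \<open>h\<close>. Thus \<open>\<delta> * W\<close> is
  the leading term and \<open>\<delta> * Q\<close> the cubic one; the first conclusion controls the
  denominator.\<close>

lemma nonlinear_drift_le:
  fixes p q :: "(nat \<times> nat) pmf"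
  assumes p: "p \<in> distributions C" and q: "q \<in> distributions C" and "C \<ge> 1" "l > 0" "\<rho>\<^sub>2 > 0" "0 < R" "R < 1"
    and R: "R = measure_pmf.prob q (full_states C)"
    and balance: "\<And>x y. x + y < C \<Longrightarrow> real (y + 1) * pmf q (x, y + 1) = \<rho>\<^sub>2 * (R / (1 - R)) * pmf q (x, y)"
    and m: "\<And>z. z \<in> states C \<Longrightarrow> m \<le> pmf q z" "m > 0"
    and small: "norm2 C p q < 1 - R"
    and linear: "drift C l \<mu>\<^sub>1 \<mu>\<^sub>2 (R / (1 - R)) p (\<lambda>z. 2 * ((pmf p z - pmf q z) / pmf q z))
        \<le> - (2 * \<kappa>) * (norm2 C p q)\<^sup>2"
  defines "s \<equiv> norm2 C p q"
  shows "1 - R - s \<le> measure_pmf.prob p (free_states C)"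
    and "drift C l \<mu>\<^sub>1 \<mu>\<^sub>2 (free_ratio C p) p (\<lambda>z. 2 * ((pmf p z - pmf q z) / pmf q z))
      \<le> (- (2 * \<kappa>) + 2 * l * ((1 - R) * sqrt (real C / \<rho>\<^sub>2) + 2 / m * s) / ((1 - R) * (1 - R - s))) * s\<^sup>2"
proof -
  define h where "h = (\<lambda>z. (pmf p z - pmf q z) / pmf q z)"
  define \<delta> where "\<delta> = (\<Sum>z\<in>free_states C. pmf q z * h z)"
  define W where "W = (\<Sum>z\<in>free_states C. pmf q z * nabla2_plus h z)"
  define Q where "Q = (\<Sum>z\<in>free_states C. pmf q z * h z * nabla2_plus h z)"
  define a where "a = measure_pmf.prob p (free_states C)"
  have q_pos: "0 < pmf q z" if "z \<in> states C" for z
    using m(1)[OF that] m(2) by simp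
  have qh: "pmf q z * h z = pmf p z - pmf q z" if "z \<in> states C" for z
    using q_pos[OF that] by (simp add: h_def)
  have N: "(\<Sum>z\<in>states C. pmf q z * (h z)\<^sup>2) = s\<^sup>2"
    unfolding s_def norm2_power2 using q_pos
    by (intro sum.cong) (auto simp: h_def power2_eq_square)
  have "s \<ge> 0" by (simp add: s_def norm2_nonneg)
  have centred: "(\<Sum>z\<in>states C. pmf q z * h z) = 0"
    by (simp add: qh sum_subtractf sum_pmf_states p q)
  note total = sum_pmf_states[OF q]
  have R': "R = (\<Sum>z\<in>full_states C. pmf q z)"
    using R by (simp add: prob_full_states)
  have a: "a = 1 - R + \<delta>"
  proof -
    have "\<delta> = (\<Sum>z\<in>free_states C. pmf p z - pmf q z)"
      unfolding \<delta>_def using free_states_subset by (intro sum.cong refl qh) auto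
    then show ?thesis
      using prob_full_states_eq[OF q] R by (simp add: a_def sum_subtractf prob_free_states)
  qed
  have \<delta>2: "\<delta>\<^sup>2 \<le> R * (1 - R) * s\<^sup>2"
    unfolding \<delta>_def N[symmetric] using q_pos
    by (intro free_mass_deviation_bound total R' centred) (auto intro: less_imp_le)
  \<comment> \<open>A crude bound on \<delta> suffices for the denominator and for the remainder;
    the sharp one is kept for the product with \<open>W\<close>.\<close>
  have "R * (1 - R) \<le> 1"
    using assms by (intro mult_le_one) auto
  then have "R * (1 - R) * s\<^sup>2 \<le> 1 * s\<^sup>2"
    by (intro mult_right_mono) auto
  then have "\<bar>\<delta>\<bar> \<le> s"
    using \<delta>2 \<open>s \<ge> 0\<close> by (intro power2_le_imp_le[of "\<bar>\<delta>\<bar>"]) auto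
  then have a_ge: "1 - R - s \<le> a" by (simp add: a)
  then show "1 - R - s \<le> measure_pmf.prob p (free_states C)" by (simp add: a_def)
  have "a > 0" using a_ge small by (simp add: s_def)
  have W2: "W\<^sup>2 \<le> real C / (\<rho>\<^sub>2 * (R / (1 - R))) * s\<^sup>2"
    unfolding W_def N[symmetric]
    by (rule free_increment_bound[OF _ total R' _ _ _ assms(3) balance])
      (use q_pos assms(5-7) in \<open>auto intro: less_imp_le\<close>)
  \<comment> \<open>The factor \<open>R\<close> of the first variance cancels against the
    \<open>R\<close> in the balance constant of the second.\<close>
  have "(\<delta> * W)\<^sup>2 \<le> (R * (1 - R) * s\<^sup>2) * (real C / (\<rho>\<^sub>2 * (R / (1 - R))) * s\<^sup>2)"
    unfolding power_mult_distrib using assms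
    by (intro mult_mono \<delta>2 W2) auto
  also have "\<dots> = ((1 - R) * sqrt (real C / \<rho>\<^sub>2) * s\<^sup>2)\<^sup>2"
  proof -
    have "(sqrt (real C / \<rho>\<^sub>2))\<^sup>2 = real C / \<rho>\<^sub>2" using assms by simp
    then show ?thesis
      using assms unfolding power_mult_distrib by (simp add: power2_eq_square)
  qed
  finally have \<delta>W: "\<bar>\<delta> * W\<bar> \<le> (1 - R) * sqrt (real C / \<rho>\<^sub>2) * s\<^sup>2"
    using assms by (intro power2_le_imp_le[of "\<bar>\<delta> * W\<bar>"]) auto
  have Q: "\<bar>Q\<bar> \<le> 2 / m * s\<^sup>2"
    unfolding Q_def N[symmetric] by (rule free_quadratic_increment_bound[OF m total])
  have \<delta>Q: "\<bar>\<delta> * Q\<bar> \<le> s * (2 / m * s\<^sup>2)"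
    unfolding abs_mult using \<open>\<bar>\<delta>\<bar> \<le> s\<close> Q \<open>s \<ge> 0\<close> by (intro mult_mono) auto
  have ratio: "free_ratio C p - R / (1 - R) = - \<delta> / (a * (1 - R))"
    using \<open>a > 0\<close> assms unfolding prob_full_states_eq[OF p] a_def[symmetric]
    by (simp add: field_simps) (simp add: a algebra_simps)
  have "drift C l \<mu>\<^sub>1 \<mu>\<^sub>2 (free_ratio C p) p (\<lambda>z. 2 * h z)
      = drift C l \<mu>\<^sub>1 \<mu>\<^sub>2 (R / (1 - R)) p (\<lambda>z. 2 * h z)
      + l * (free_ratio C p - R / (1 - R)) * (\<Sum>z\<in>states C.
          indicator (free_states C) z * (nabla2_plus (\<lambda>z. 2 * h z) z * pmf p z))"
    unfolding drift_eq_generator generator_change_rate[of C l \<mu>\<^sub>1 \<mu>\<^sub>2 "free_ratio C p" _ _ "R / (1 - R)"]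
      sum_distrib_left sum.distrib[symmetric]
    by (rule sum.cong) (simp_all only: algebra_simps)
  also have "(\<Sum>z\<in>states C. indicator (free_states C) z * (nabla2_plus (\<lambda>z. 2 * h z) z * pmf p z)) = 2 * (W + Q)"
    unfolding sum_free_indicator W_def Q_def sum.distrib[symmetric] sum_distrib_left
  proof (rule sum.cong)
    fix z assume "z \<in> free_states C"
    then have "pmf p z = pmf q z + pmf q z * h z"
      using qh[OF subsetD[OF free_states_subset]] by simp
    moreover have "nabla2_plus (\<lambda>z. 2 * h z) z = 2 * nabla2_plus h z"
      by (simp add: nabla2_plus_def split_beta)
    ultimately show "nabla2_plus (\<lambda>z. 2 * h z) z * pmf p z
        = 2 * (pmf q z * nabla2_plus h z + pmf q z * h z * nabla2_plus h z)"
      by (simp add: algebra_simps)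
  qed simp
  also have "l * (free_ratio C p - R / (1 - R)) * (2 * (W + Q)) = 2 * l * (- (\<delta> * W) - \<delta> * Q) / ((1 - R) * a)"
  proof -
    have "l * - \<delta> * (2 * (W + Q)) = 2 * l * (- (\<delta> * W) - \<delta> * Q)"
      by algebra
    then show ?thesis
      unfolding ratio times_divide_eq_right times_divide_eq_left by (simp only: mult.commute[of a])
  qed
  \<comment> \<open>The old numerator has no definite sign, so it is bounded by a nonnegative one
    while \<open>a\<close> is replaced by its lower bound.\<close>
  also have "\<dots> \<le> 2 * l * (((1 - R) * sqrt (real C / \<rho>\<^sub>2) + 2 / m * s) * s\<^sup>2) / ((1 - R) * (1 - R - s))"
  proof (rule frac_le)
    have "- (\<delta> * W) - \<delta> * Q \<le> (1 - R) * sqrt (real C / \<rho>\<^sub>2) * s\<^sup>2 + s * (2 / m * s\<^sup>2)"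
      using \<delta>W \<delta>Q by linarith
    also have "\<dots> = ((1 - R) * sqrt (real C / \<rho>\<^sub>2) + 2 / m * s) * s\<^sup>2"
      unfolding distrib_right by (simp only: mult_ac)
    finally show "2 * l * (- (\<delta> * W) - \<delta> * Q) \<le> 2 * l * (((1 - R) * sqrt (real C / \<rho>\<^sub>2) + 2 / m * s) * s\<^sup>2)"
      using \<open>l > 0\<close> by simp
    show "0 \<le> 2 * l * (((1 - R) * sqrt (real C / \<rho>\<^sub>2) + 2 / m * s) * s\<^sup>2)"
      using assms(3-7) m(2) \<open>s \<ge> 0\<close> by (intro mult_nonneg_nonneg add_nonneg_nonneg) auto
    show "0 < (1 - R) * (1 - R - s)"
      using small \<open>R < 1\<close> by (simp add: s_def)
    show "(1 - R) * (1 - R - s) \<le> (1 - R) * a"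
      using a_ge \<open>R < 1\<close> by (intro mult_left_mono) auto
  qed
  also have "\<dots> = 2 * l * ((1 - R) * sqrt (real C / \<rho>\<^sub>2) + 2 / m * s) / ((1 - R) * (1 - R - s)) * s\<^sup>2"
    by (simp only: mult.assoc times_divide_eq_left)
  finally have "drift C l \<mu>\<^sub>1 \<mu>\<^sub>2 (free_ratio C p) p (\<lambda>z. 2 * h z)
      \<le> drift C l \<mu>\<^sub>1 \<mu>\<^sub>2 (R / (1 - R)) p (\<lambda>z. 2 * h z)
        + 2 * l * ((1 - R) * sqrt (real C / \<rho>\<^sub>2) + 2 / m * s) / ((1 - R) * (1 - R - s)) * s\<^sup>2"
    by simp
  moreover have "drift C l \<mu>\<^sub>1 \<mu>\<^sub>2 (R / (1 - R)) p (\<lambda>z. 2 * h z) \<le> - (2 * \<kappa>) * s\<^sup>2"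
    using linear unfolding h_def s_def .
  ultimately show "drift C l \<mu>\<^sub>1 \<mu>\<^sub>2 (free_ratio C p) p (\<lambda>z. 2 * ((pmf p z - pmf q z) / pmf q z))
      \<le> (- (2 * \<kappa>) + 2 * l * ((1 - R) * sqrt (real C / \<rho>\<^sub>2) + 2 / m * s) / ((1 - R) * (1 - R - s))) * s\<^sup>2"
    unfolding distrib_right h_def by linarith
qed

text \<open>At \<open>s = 0\<close> the coefficient is \<open>- 2 * (\<kappa> - l / c * B)\<close>.
  Half of this rate is given up, and by continuity it absorbs the terms in \<open>s\<close>.
  Requiring \<open>\<epsilon> < c\<close> keeps the denominator positive.\<close>

lemma decay_coefficient_negative:
  fixes c B M l \<kappa> :: real
  assumes "0 < c" and "l / c * B < \<kappa>"
  shows "\<exists>\<epsilon>>0. \<epsilon> < c \<and> (\<forall>s. 0 \<le> s \<longrightarrow> s \<le> \<epsilon> \<longrightarrow>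
    - (2 * \<kappa>) + 2 * l * (c * B + M * s) / (c * (c - s)) \<le> - (\<kappa> - l / c * B))"
proof -
  define F where "F = (\<lambda>s. - (2 * \<kappa>) + 2 * l * (c * B + M * s) / (c * (c - s)))"
  have "isCont F 0"
    unfolding F_def using assms by (intro continuous_intros) auto
  moreover have F0: "F 0 < - (\<kappa> - l / c * B)"
  proof -
    define x where "x = l / c * B"
    have "F 0 = - (2 * \<kappa>) + 2 * x"
      using assms(1) by (simp add: F_def x_def)
    then show ?thesis using assms(2) unfolding x_def[symmetric] by linarith
  qed
  ultimately have "eventually (\<lambda>s. F s < - (\<kappa> - l / c * B)) (at 0)"
    unfolding isCont_def by (intro order_tendstoD)
  then obtain d where d: "d > 0" "\<And>s. s \<noteq> 0 \<Longrightarrow> \<bar>s\<bar> < d \<Longrightarrow> F s < - (\<kappa> - l / c * B)"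
    unfolding eventually_at by (auto simp: dist_real_def)
  show ?thesis
  proof (intro exI[of _ "min d c / 2"] conjI allI impI)
    fix s assume "0 \<le> s" "s \<le> min d c / 2"
    then have "F s < - (\<kappa> - l / c * B)"
      using d F0 by (cases "s = 0") auto
    then show "- (2 * \<kappa>) + 2 * l * (c * B + M * s) / (c * (c - s)) \<le> - (\<kappa> - l / c * B)"
      by (simp add: F_def)
  qed (use d assms in auto)
qed

text \<open>The rate \<open>r\<close> has to agree with the true ratio only inside the ball, so the
  result applies to the truncated equation as well as to genuine nonlinear solutions. The barrier is
  the initial squared norm, with strip up to the squared radius.\<close>

lemma trapped_solution:
  assumes local: "\<And>p. p \<in> distributions C \<Longrightarrow> norm2 C p q \<le> \<epsilon> \<Longrightarrow>
      drift C l \<mu>\<^sub>1 \<mu>\<^sub>2 (free_ratio C p) p (\<lambda>z. 2 * ((pmf p z - pmf q z) / pmf q z)) \<le> - k * (norm2 C p q)\<^sup>2"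
    and "0 \<le> k" and dist: "\<And>t. 0 \<le> t \<Longrightarrow> \<Lambda> t \<in> distributions C"
    and der: "\<And>t f. 0 \<le> t \<Longrightarrow> ((\<lambda>s. pairing C (\<Lambda> s) f) has_real_derivative
       drift C l \<mu>\<^sub>1 \<mu>\<^sub>2 (r t) (\<Lambda> t) f) (at t within {0..})"
    and rate: "\<And>t. 0 \<le> t \<Longrightarrow> norm2 C (\<Lambda> t) q \<le> \<epsilon> \<Longrightarrow> r t = free_ratio C (\<Lambda> t)"
    and start: "norm2 C (\<Lambda> 0) q < \<epsilon>"
  shows "0 \<le> t \<Longrightarrow> norm2 C (\<Lambda> t) q \<le> norm2 C (\<Lambda> 0) q" and "norm2_decay C q k \<Lambda>"
proof -
  define g' where "g' = (\<lambda>t. drift C l \<mu>\<^sub>1 \<mu>\<^sub>2 (r t) (\<Lambda> t) (\<lambda>z. 2 * ((pmf (\<Lambda> t) z - pmf q z) / pmf q z)))"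
  have g': "((\<lambda>s. (norm2 C (\<Lambda> s) q)\<^sup>2) has_real_derivative g' t) (at t within {0..})" if "0 \<le> t" for t
    unfolding g'_def by (intro norm2_power2_derivative der that)
  have decay: "g' t \<le> - k * (norm2 C (\<Lambda> t) q)\<^sup>2" if "0 \<le> t" "norm2 C (\<Lambda> t) q \<le> \<epsilon>" for t
    unfolding g'_def rate[OF that] by (rule local[OF dist that(2)]) (rule that)
  have "0 < \<epsilon>" using start norm2_nonneg[of C "\<Lambda> 0" q] by simp
  have sq_le: "(norm2 C (\<Lambda> t) q)\<^sup>2 \<le> (norm2 C (\<Lambda> 0) q)\<^sup>2" if "0 \<le> t" for t
  proof (rule derivative_barrier[where g = "\<lambda>t. (norm2 C (\<Lambda> t) q)\<^sup>2" and g' = g' and b = "\<epsilon>\<^sup>2"])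
    show "(norm2 C (\<Lambda> 0) q)\<^sup>2 < \<epsilon>\<^sup>2"
      using start by (intro power_strict_mono norm2_nonneg) auto
    fix s assume s: "0 \<le> (s :: real)"
    show "((\<lambda>t. (norm2 C (\<Lambda> t) q)\<^sup>2) has_real_derivative g' s) (at s within {0..})"
      by (rule g'[OF s])
    assume "(norm2 C (\<Lambda> s) q)\<^sup>2 < \<epsilon>\<^sup>2"
    then have "g' s \<le> - k * (norm2 C (\<Lambda> s) q)\<^sup>2"
      using s \<open>0 < \<epsilon>\<close> by (intro decay) (auto dest: power_less_imp_less_base)
    also have "\<dots> \<le> 0" using \<open>0 \<le> k\<close> by simp
    finally show "g' s \<le> 0" .
  qed (use that in simp_all)
  have le: "norm2 C (\<Lambda> t) q \<le> norm2 C (\<Lambda> 0) q" if "0 \<le> t" for t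
    by (rule power2_le_imp_le[OF sq_le[OF that] norm2_nonneg])
  then show "0 \<le> t \<Longrightarrow> norm2 C (\<Lambda> t) q \<le> norm2 C (\<Lambda> 0) q" .
  have "norm2 C (\<Lambda> t) q \<le> \<epsilon>" if "0 \<le> t" for t
    using le[OF that] start by simp
  then show "norm2_decay C q k \<Lambda>"
    unfolding norm2_decay_def using g' decay by blast
qed

text \<open>The integrating factor \<open>exp (k * t)\<close> makes the squared norm nonincreasing;
  the square root halves the rate.\<close>

lemma norm2_decay_exponential:
  assumes "norm2_decay C q k \<Lambda>" "0 \<le> t"
  shows "norm2 C (\<Lambda> t) q \<le> exp (- (k / 2) * t) * norm2 C (\<Lambda> 0) q"
proof -
  obtain D where D: "\<And>t. 0 \<le> t \<Longrightarrow>
      ((\<lambda>s. (norm2 C (\<Lambda> s) q)\<^sup>2) has_real_derivative D t) (at t within {0..})"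
    "\<And>t. 0 \<le> t \<Longrightarrow> D t \<le> - k * (norm2 C (\<Lambda> t) q)\<^sup>2"
    using assms(1) unfolding norm2_decay_def by metis
  have "exp (k * t) * (norm2 C (\<Lambda> t) q)\<^sup>2 \<le> exp (k * 0) * (norm2 C (\<Lambda> 0) q)\<^sup>2"
  proof (rule nonincreasing_nonneg_half_line[where g = "\<lambda>t. exp (k * t) * (norm2 C (\<Lambda> t) q)\<^sup>2"])
    fix s assume s: "0 \<le> (s :: real)"
    have "((\<lambda>t. exp (k * t)) has_real_derivative exp (k * s) * k) (at s within {0..})"
      by (auto intro!: derivative_eq_intros)
    from DERIV_mult[OF this D(1)[OF s]]
    show "((\<lambda>t. exp (k * t) * (norm2 C (\<Lambda> t) q)\<^sup>2) has_real_derivative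
        exp (k * s) * (k * (norm2 C (\<Lambda> s) q)\<^sup>2 + D s)) (at s within {0..})"
      by (simp add: algebra_simps)
  next
    fix s assume "0 < (s :: real)"
    then show "exp (k * s) * (k * (norm2 C (\<Lambda> s) q)\<^sup>2 + D s) \<le> 0"
      using D(2)[of s] by (intro mult_nonneg_nonpos) auto
  qed (use assms in auto)
  then have "(norm2 C (\<Lambda> t) q)\<^sup>2 \<le> exp (- (k * t)) * (norm2 C (\<Lambda> 0) q)\<^sup>2"
    by (simp add: exp_minus field_simps)
  also have "\<dots> = (exp (- (k / 2) * t) * norm2 C (\<Lambda> 0) q)\<^sup>2"
    by (simp add: power_mult_distrib flip: exp_of_nat_mult)
  finally show ?thesis
    by (rule power2_le_imp_le) (simp add: norm2_nonneg)
qed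

text \<open>For a free mass \<open>a\<close> between \<open>d\<close> and 1 this is
  \<open>(1 - a) / a\<close>, the ratio of full to free mass. Cutting at \<open>d\<close> removes
  the pole, and cutting at 1 keeps the rate nonnegative.\<close>

lemma bounded_lipschitz_truncated_odds:
  assumes "0 < d" "d \<le> 1"
  shows "bounded_lipschitz (\<lambda>a :: real. 1 / max d (min 1 a) - 1)"
proof -
  have "dist (1 / max d (min 1 a) - 1) (1 / max d (min 1 b) - 1) \<le> 1 / d\<^sup>2 * dist a b" for a b
  proof -
    define u v where "u = max d (min 1 a)" and "v = max d (min 1 b)"
    have "\<bar>max d x - max d y\<bar> \<le> \<bar>x - y\<bar>" "\<bar>min 1 x - min 1 y\<bar> \<le> \<bar>x - y\<bar>" for x y :: real
      by (simp_all add: max_def min_def)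
    then have uv: "d \<le> u" "d \<le> v" "\<bar>u - v\<bar> \<le> \<bar>a - b\<bar>"
      unfolding u_def v_def by (auto intro: order_trans)
    have "1 / u - 1 / v = (v - u) / (u * v)"
      using uv assms by (simp add: field_simps)
    then have "\<bar>1 / u - 1 / v\<bar> = \<bar>u - v\<bar> / (u * v)"
      using uv assms by (simp add: abs_mult abs_minus_commute)
    also have "\<dots> \<le> \<bar>a - b\<bar> / (d * d)"
      using uv assms by (intro frac_le mult_mono) auto
    finally have "dist (1 / u - 1) (1 / v - 1) \<le> 1 / d\<^sup>2 * dist a b"
      by (simp add: dist_real_def power2_eq_square)
    then show ?thesis unfolding u_def v_def .
  qed
  then have "(1 / d\<^sup>2)-lipschitz_on UNIV (\<lambda>a. 1 / max d (min 1 a) - 1)"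
    by (auto intro: lipschitz_onI)
  moreover have "bounded (range (\<lambda>a :: real. 1 / max d (min 1 a) - 1))"
  proof -
    have "norm (1 / max d (min 1 a) - 1) \<le> 1 / d + 1" for a
    proof -
      define u where "u = max d (min 1 a)"
      have "d \<le> u" by (simp add: u_def)
      then have "0 \<le> 1 / u" "1 / u \<le> 1 / d"
        using assms by (simp_all add: frac_le)
      then show ?thesis unfolding u_def[symmetric] real_norm_def by linarith
    qed
    then show ?thesis unfolding bounded_iff by blast
  qed
  ultimately show ?thesis unfolding bounded_lipschitz_def by blast
qed

theorem theorem2p10:
  fixes C :: nat and l \<mu>\<^sub>1 \<mu>\<^sub>2 \<rho>\<^sub>1 \<rho>\<^sub>2 R \<kappa> :: real and \<pi> :: "(nat \<times> nat) pmf"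
  assumes "C \<ge> 1" and "l > 0" and "0 < \<mu>\<^sub>2" and "\<mu>\<^sub>2 < \<mu>\<^sub>1"
    and "\<rho>\<^sub>1 = l / \<mu>\<^sub>1" and "\<rho>\<^sub>2 = l / \<mu>\<^sub>2"
    and "0 < R" and "R < 1"
    and "\<pi> = inv_dist C \<rho>\<^sub>1 \<rho>\<^sub>2 R"
    and "R = measure_pmf.prob \<pi> (full_states C)"
    and "is_spectral_gap C l \<mu>\<^sub>1 \<mu>\<^sub>2 R \<kappa>"
    and "\<kappa> > l / (1 - R) * sqrt (real C / \<rho>\<^sub>2)"
  shows "(\<exists>q>0. \<exists>\<epsilon>\<^sub>0>0. \<forall>p\<in>distributions C. norm2 C p \<pi> \<le> \<epsilon>\<^sub>0 \<longrightarrow>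
            (\<exists>\<Lambda>. nonlinear_solution C l \<mu>\<^sub>1 \<mu>\<^sub>2 \<Lambda> \<and> \<Lambda> 0 = p) \<and>
            (\<forall>\<Lambda>. nonlinear_solution C l \<mu>\<^sub>1 \<mu>\<^sub>2 \<Lambda> \<and> \<Lambda> 0 = p \<longrightarrow> norm2_decay C \<pi> q \<Lambda>))
       \<and> exponentially_stable_equilibrium C l \<mu>\<^sub>1 \<mu>\<^sub>2 \<pi>"
proof -
  have pos: "\<rho>\<^sub>1 > 0" "\<rho>\<^sub>2 > 0" "0 < \<mu>\<^sub>1"
    using assms(2-6) by auto
  note \<pi>_pos = pmf_inv_dist_pos[OF pos(1,2) assms(7,8), of _ C, folded assms(9)]
  have \<pi>_dist: "\<pi> \<in> distributions C"
    unfolding assms(9) by (rule inv_dist_in_distributions[OF pos(1,2) assms(7,8)])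
  \<comment> \<open>A uniform positive lower bound exists because there are finitely many states and
    \<pi> charges each of them.\<close>
  define m where "m = Min (pmf \<pi> ` states C)"
  have "(0, 0) \<in> states C" by (simp add: states_def)
  then have "m > 0"
    unfolding m_def by (subst Min_gr_iff) (auto intro: \<pi>_pos)
  have m_le: "m \<le> pmf \<pi> z" if "z \<in> states C" for z
    unfolding m_def using that by simp
  have linear: "drift C l \<mu>\<^sub>1 \<mu>\<^sub>2 (R / (1 - R)) p (\<lambda>z. 2 * ((pmf p z - pmf \<pi> z) / pmf \<pi> z))
      \<le> - (2 * \<kappa>) * (norm2 C p \<pi>)\<^sup>2" if "p \<in> distributions C" for p
    unfolding assms(9,5,6) using assms(2,3,7,8,11) pos that
    by (intro gap_bound_drift_le) (auto simp: is_spectral_gap_def)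
  define q where "q = \<kappa> - l / (1 - R) * sqrt (real C / \<rho>\<^sub>2)"
  have "q > 0" using assms(12) by (simp add: q_def)
  have "0 < 1 - R" using assms(8) by simp
  from decay_coefficient_negative[OF this assms(12), of "2 / m", folded q_def]
  obtain \<epsilon> where \<epsilon>: "0 < \<epsilon>" "\<epsilon> < 1 - R" "\<And>s. 0 \<le> s \<Longrightarrow> s \<le> \<epsilon> \<Longrightarrow>
      - (2 * \<kappa>) + 2 * l * ((1 - R) * sqrt (real C / \<rho>\<^sub>2) + 2 / m * s) / ((1 - R) * (1 - R - s)) \<le> - q"
    by blast
  have free: "1 - R - \<epsilon> \<le> measure_pmf.prob p (free_states C)"
    and local: "drift C l \<mu>\<^sub>1 \<mu>\<^sub>2 (free_ratio C p) p (\<lambda>z. 2 * ((pmf p z - pmf \<pi> z) / pmf \<pi> z))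
      \<le> - q * (norm2 C p \<pi>)\<^sup>2" if p: "p \<in> distributions C" "norm2 C p \<pi> \<le> \<epsilon>" for p
  proof -
    note balance = pmf_inv_dist_balance[OF pos(1,2) assms(7,8), of _ _ C, folded assms(9)]
    have small: "norm2 C p \<pi> < 1 - R" using p \<epsilon> by simp
    note est = nonlinear_drift_le[OF p(1) \<pi>_dist assms(1,2) pos(2) assms(7,8,10) _ _
        \<open>m > 0\<close> small linear[OF p(1)]]
    have "1 - R - norm2 C p \<pi> \<le> measure_pmf.prob p (free_states C)"
      by (rule est(1)) (erule balance m_le)+
    then show "1 - R - \<epsilon> \<le> measure_pmf.prob p (free_states C)"
      using p by simp
    show "drift C l \<mu>\<^sub>1 \<mu>\<^sub>2 (free_ratio C p) p (\<lambda>z. 2 * ((pmf p z - pmf \<pi> z) / pmf \<pi> z))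
        \<le> - q * (norm2 C p \<pi>)\<^sup>2"
      by (rule order_trans[OF est(2)])
        ((erule balance m_le)+, intro mult_right_mono \<epsilon>(3) norm2_nonneg p zero_le_power2)
  qed
  have decay: "norm2_decay C \<pi> q \<Lambda>"
    if "nonlinear_solution C l \<mu>\<^sub>1 \<mu>\<^sub>2 \<Lambda>" "norm2 C (\<Lambda> 0) \<pi> < \<epsilon>" for \<Lambda>
    using that \<open>q > 0\<close> unfolding nonlinear_solution_def
    by (intro trapped_solution(2)[OF local, where r = "\<lambda>t. free_ratio C (\<Lambda> t)"]) auto
  \<comment> \<open>In the ball of radius \<epsilon> the free mass is at least this value, so the
    truncation at \<open>d\<close> changes nothing there.\<close>
  define d where "d = 1 - R - \<epsilon>"
  have d: "0 < d" "d \<le> 1" using \<epsilon> assms(7) by (auto simp: d_def)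
  have existence: "\<exists>\<Lambda>. nonlinear_solution C l \<mu>\<^sub>1 \<mu>\<^sub>2 \<Lambda> \<and> \<Lambda> 0 = p \<and>
      (\<forall>t\<ge>0. norm2 C (\<Lambda> t) \<pi> \<le> norm2 C p \<pi>)"
    if p: "p \<in> distributions C" "norm2 C p \<pi> < \<epsilon>" for p
  proof -
    define \<phi> where "\<phi> = (\<lambda>a :: real. 1 / max d (min 1 a) - 1)"
    have "0 \<le> \<phi> a" for a
    proof -
      have "0 < max d (min 1 a)" "max d (min 1 a) \<le> 1" using d by auto
      then show ?thesis unfolding \<phi>_def by simp
    qed
    note clamped = clamped_solution_exists[OF less_imp_le[OF assms(2)] less_imp_le[OF pos(3)]
        less_imp_le[OF assms(3)] this bounded_lipschitz_truncated_odds[OF d, folded \<phi>_def] p(1)]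
    obtain \<Lambda> where \<Lambda>: "\<Lambda> 0 = p" "\<And>t. 0 \<le> t \<Longrightarrow> \<Lambda> t \<in> distributions C"
      "\<And>t f. 0 \<le> t \<Longrightarrow> ((\<lambda>s. pairing C (\<Lambda> s) f) has_real_derivative
         drift C l \<mu>\<^sub>1 \<mu>\<^sub>2 (\<phi> (measure_pmf.prob (\<Lambda> t) (free_states C))) (\<Lambda> t) f) (at t within {0..})"
      by (rule clamped) blast
    have rate: "\<phi> (measure_pmf.prob (\<Lambda> t) (free_states C)) = free_ratio C (\<Lambda> t)"
      if "0 \<le> t" "norm2 C (\<Lambda> t) \<pi> \<le> \<epsilon>" for t
    proof -
      have "d \<le> measure_pmf.prob (\<Lambda> t) (free_states C)"
        using free[OF \<Lambda>(2) that(2)] that(1) by (simp add: d_def)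
      then show ?thesis
        using d unfolding prob_full_states_eq[OF \<Lambda>(2)[OF that(1)]]
        by (simp add: \<phi>_def max_absorb2 diff_divide_distrib)
    qed
    have le: "norm2 C (\<Lambda> t) \<pi> \<le> norm2 C p \<pi>" if "0 \<le> t" for t
    proof -
      have "norm2 C (\<Lambda> t) \<pi> \<le> norm2 C (\<Lambda> 0) \<pi>"
        by (rule trapped_solution(1)[where \<epsilon> = \<epsilon>, OF local _ \<Lambda>(2,3) rate])
          (use \<open>q > 0\<close> p that \<Lambda>(1) in auto)
      then show ?thesis by (simp add: \<Lambda>(1))
    qed
    have "nonlinear_solution C l \<mu>\<^sub>1 \<mu>\<^sub>2 \<Lambda>"
      unfolding nonlinear_solution_def
    proof (intro allI impI conjI)
      fix t f assume t: "0 \<le> (t :: real)"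
      then have small: "norm2 C (\<Lambda> t) \<pi> \<le> \<epsilon>" using le[OF t] p by simp
      show "\<Lambda> t \<in> distributions C" by (rule \<Lambda>(2)[OF t])
      show "0 < measure_pmf.prob (\<Lambda> t) (free_states C)"
        using free[OF \<Lambda>(2)[OF t] small] d by (simp add: d_def)
      show "((\<lambda>s. pairing C (\<Lambda> s) f) has_real_derivative
          drift C l \<mu>\<^sub>1 \<mu>\<^sub>2 (free_ratio C (\<Lambda> t)) (\<Lambda> t) f) (at t within {0..})"
        using \<Lambda>(3)[OF t, of f] unfolding rate[OF t small] .
    qed
    then show ?thesis using le \<Lambda>(1) by blast
  qed
  \<comment> \<open>Instead of verifying stationarity by computation, the solution started at \<pi>
    is used: its norm never exceeds the initial value 0, so it is constantly \<pi>.\<close>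
  have equilibrium: "nonlinear_solution C l \<mu>\<^sub>1 \<mu>\<^sub>2 (\<lambda>_. \<pi>)"
  proof -
    have "norm2 C \<pi> \<pi> = 0" by (simp add: norm2_def)
    then obtain \<Lambda> where \<Lambda>: "nonlinear_solution C l \<mu>\<^sub>1 \<mu>\<^sub>2 \<Lambda>" "\<forall>t\<ge>0. norm2 C (\<Lambda> t) \<pi> \<le> 0"
      using existence[OF \<pi>_dist] \<epsilon>(1) by auto
    have const: "\<Lambda> t = \<pi>" if "0 \<le> t" for t
    proof -
      have "norm2 C (\<Lambda> t) \<pi> = 0"
        using \<Lambda>(2) that norm2_nonneg[of C "\<Lambda> t" \<pi>] by (simp add: antisym)
      then show ?thesis
        using norm2_eq_0_iff[OF _ \<pi>_dist \<pi>_pos] \<Lambda>(1) that unfolding nonlinear_solution_def by blast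
    qed
    show ?thesis
      unfolding nonlinear_solution_def
    proof (intro allI impI conjI)
      fix t f assume t: "0 \<le> (t :: real)"
      show "\<pi> \<in> distributions C" by (rule \<pi>_dist)
      show "0 < measure_pmf.prob \<pi> (free_states C)"
        using \<Lambda>(1) const[OF t] t unfolding nonlinear_solution_def by metis
      have "((\<lambda>s. pairing C (\<Lambda> s) f) has_real_derivative
          drift C l \<mu>\<^sub>1 \<mu>\<^sub>2 (free_ratio C \<pi>) \<pi> f) (at t within {0..})"
        using \<Lambda>(1) const[OF t] t unfolding nonlinear_solution_def by metis
      then show "((\<lambda>s. pairing C \<pi> f) has_real_derivative
          drift C l \<mu>\<^sub>1 \<mu>\<^sub>2 (free_ratio C \<pi>) \<pi> f) (at t within {0..})"
        by (rule has_field_derivative_transform_within[where d = 1]) (auto simp: const t)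
    qed
  qed
  \<comment> \<open>Trapping needs a start strictly inside the ball of radius \<epsilon>, whereas
    the claim allows equality; halving the radius reconciles the two.\<close>
  have exists: "\<exists>\<Lambda>. nonlinear_solution C l \<mu>\<^sub>1 \<mu>\<^sub>2 \<Lambda> \<and> \<Lambda> 0 = p"
    if "p \<in> distributions C" "norm2 C p \<pi> \<le> \<epsilon> / 2" for p
  proof -
    have "norm2 C p \<pi> < \<epsilon>" using that(2) \<epsilon>(1) by simp
    then show ?thesis using existence[OF that(1)] by blast
  qed
  have decays: "norm2_decay C \<pi> q \<Lambda>"
    if "nonlinear_solution C l \<mu>\<^sub>1 \<mu>\<^sub>2 \<Lambda>" "norm2 C (\<Lambda> 0) \<pi> \<le> \<epsilon> / 2" for \<Lambda>
    using decay[OF that(1)] that(2) \<epsilon>(1) by simp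
  show ?thesis
  proof (rule conjI)
    show "\<exists>q>0. \<exists>\<epsilon>\<^sub>0>0. \<forall>p\<in>distributions C. norm2 C p \<pi> \<le> \<epsilon>\<^sub>0 \<longrightarrow>
            (\<exists>\<Lambda>. nonlinear_solution C l \<mu>\<^sub>1 \<mu>\<^sub>2 \<Lambda> \<and> \<Lambda> 0 = p) \<and>
            (\<forall>\<Lambda>. nonlinear_solution C l \<mu>\<^sub>1 \<mu>\<^sub>2 \<Lambda> \<and> \<Lambda> 0 = p \<longrightarrow> norm2_decay C \<pi> q \<Lambda>)"
    proof (rule exI[of _ q], rule conjI[OF \<open>q > 0\<close>], rule exI[of _ "\<epsilon> / 2"],
        intro conjI ballI impI allI)
      fix p assume p: "p \<in> distributions C" "norm2 C p \<pi> \<le> \<epsilon> / 2"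
      show "\<exists>\<Lambda>. nonlinear_solution C l \<mu>\<^sub>1 \<mu>\<^sub>2 \<Lambda> \<and> \<Lambda> 0 = p"
        by (rule exists[OF p])
      fix \<Lambda> assume "nonlinear_solution C l \<mu>\<^sub>1 \<mu>\<^sub>2 \<Lambda> \<and> \<Lambda> 0 = p"
      then show "norm2_decay C \<pi> q \<Lambda>" using p(2) by (intro decays) auto
    qed (use \<epsilon>(1) in simp)
    have "norm2 C (\<Lambda> t) \<pi> \<le> 1 * exp (- (q / 2) * t) * norm2 C (\<Lambda> 0) \<pi>"
      if "nonlinear_solution C l \<mu>\<^sub>1 \<mu>\<^sub>2 \<Lambda>" "norm2 C (\<Lambda> 0) \<pi> \<le> \<epsilon> / 2" "0 \<le> t" for \<Lambda> t
      using norm2_decay_exponential[OF decays[OF that(1,2)] that(3)] by simp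
    then have "\<forall>p\<in>distributions C. norm2 C p \<pi> \<le> \<epsilon> / 2 \<longrightarrow>
        (\<exists>\<Lambda>. nonlinear_solution C l \<mu>\<^sub>1 \<mu>\<^sub>2 \<Lambda> \<and> \<Lambda> 0 = p) \<and>
        (\<forall>\<Lambda>. nonlinear_solution C l \<mu>\<^sub>1 \<mu>\<^sub>2 \<Lambda> \<and> \<Lambda> 0 = p \<longrightarrow>
           (\<forall>t\<ge>0. norm2 C (\<Lambda> t) \<pi> \<le> 1 * exp (- (q / 2) * t) * norm2 C p \<pi>))"
      using exists by blast
    moreover have "q / 2 > 0" "\<epsilon> / 2 > 0" using \<open>q > 0\<close> \<epsilon>(1) by auto
    ultimately show "exponentially_stable_equilibrium C l \<mu>\<^sub>1 \<mu>\<^sub>2 \<pi>"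
      unfolding exponentially_stable_equilibrium_def using equilibrium zero_less_one by blast
  qed
qed

end
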